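(* Let $N\ge 1$, $\beta\in(0,1)$, let $t:\mathbb{N}\to[0,1]$ be the function associated with $N$ and $\beta$ defined in the context, and set $\varepsilon(k)\doteq 1-t(k)$. Let $F:\mathbb{R}^n\to\mathbb{R}^n$, let $(\Delta,\mathcal{F},\mathbb{P})$ be a probability space, let $\{\mathcal{X}_\delta\}_{\delta\in\Delta}$ be a family of subsets of $\mathbb{R}^n$, and let $\delta_1,\dots,\delta_N$ be independent samples from $(\Delta,\mathcal{F},\mathbb{P})$. Assume Existence-and-uniqueness and Non-degeneracy (as stated in the context). Let $x^\star$ be the solution of the variational inequality: $x^\star\in\mathcal{X}\doteq\bigcap_{i=1}^N\mathcal{X}_{\delta_i}$ and $F(x^\star)^\top(x-x^\star)\ge 0$ for all $x\in\mathcal{X}$; let $s^\star$ be its number of support constraints and $V$ the risk. (i) For any $\Delta$ and $\mathbb{P}$ it holds that $$\mathbb{P}^N[V(x^\star)\le\varepsilon(s^\star)]\ge 1-\beta .$$ (ii) If, in addition, the constraint sets $\{\mathcal{X}_{\delta_i}\}_{i=1}^N$ are convex (for every tuple of samples), then $s^\star\le n$, and for all $\Delta$ and $\mathbb{P}$ $$\mathbb{P}^N[V(x^\star)\le\varepsilon(n)]\ge 1-\beta .$$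
   Context: Variational inequality: for samples $(\delta_1,\dots,\delta_N)$, find $x^\star\in\mathcal{X}\doteq\bigcap_{i=1}^N\mathcal{X}_{\delta_i}$ such that $F(x^\star)^\top(x-x^\star)\ge0$ for all $x\in\mathcal{X}$. If no constraint is present, $\mathcal{X}=\mathbb{R}^n$. Existence-and-uniqueness (standing assumption): for any number $N\geq 1$ of samples and any tuple $(\delta_1,\dots,\delta_N)\in\Delta^N$, the variational inequality admits a unique solution, denoted $x^\star$. Risk: $V(x)\doteq\mathbb{P}\{\delta\in\Delta : x\notin\mathcal{X}_\delta\}$. Since $x^\star$ depends on $(\delta_1,\dots,\delta_N)$, $V(x^\star)$ is a random variable. Support constraint: the constraint $x\in\mathcal{X}_{\delta_i}$ is of support if its removal (i.e. replacing $\mathcal{X}$ by $\bigcap_{l\ne i}\mathcal{X}_{\delta_l}$) modifies the solution $x^\star$. $S^\star$ is the set of support constraints and $s^\star=|S^\star|$. Non-degeneracy: $\mathbb{P}^N$-almost surely, $x^\star$ coincides with the (unique) solution of the variational inequality obtained by eliminating all the constraints that are not of support. The function $t$: for $k\in\{0,\dots,N-1\}$, $t(k)$ is the unique solution in $(0,1)$ of the polynomial equation in $t$ $$\frac{\beta}{N+1}\sum_{l=k}^{N}\binom{l}{k}t^{l-k}-\binom{N}{k}t^{N-k}=0,$$ (existence and uniqueness of this root is a known fact), and $t(k)=0$ for $k\ge N$. All quantities involved are assumed measurable. $\mathbb{P}^N$ is the $N$-fold product measure. *)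

theory Defs
  imports "HOL-Probability.Probability"
begin

definition VI_sol :: "('a::real_inner \<Rightarrow> 'a) \<Rightarrow> 'a set \<Rightarrow> 'a \<Rightarrow> bool" where
  "VI_sol F K x \<longleftrightarrow> x \<in> K \<and> (\<forall>y\<in>K. F x \<bullet> (y - x) \<ge> 0)"

definition VI_unique_sol :: "('a::real_inner \<Rightarrow> 'a) \<Rightarrow> 'a set \<Rightarrow> 'a \<Rightarrow> bool" where
  "VI_unique_sol F K x \<longleftrightarrow> VI_sol F K x \<and> (\<forall>y. VI_sol F K y \<longrightarrow> y = x)"

text \<open>A sample is a function \<open>\<omega>\<close> on the index set \<open>{1..N}\<close>; the definitions below also
  admit smaller index sets \<open>I\<close>, which correspond to removing constraints.
  For \<open>I = {}\<close> the intersection is the whole space.\<close>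

definition feasible_set :: "('d \<Rightarrow> 'a set) \<Rightarrow> nat set \<Rightarrow> (nat \<Rightarrow> 'd) \<Rightarrow> 'a set" where
  "feasible_set X I \<omega> = (\<Inter>i\<in>I. X (\<omega> i))"

definition xstar ::
  "('a::real_inner \<Rightarrow> 'a) \<Rightarrow> ('d \<Rightarrow> 'a set) \<Rightarrow> nat set \<Rightarrow> (nat \<Rightarrow> 'd) \<Rightarrow> 'a" where
  "xstar F X I \<omega> = (THE x. VI_sol F (feasible_set X I \<omega>) x)"

text \<open>Existence and uniqueness are only assumed for at least one sample. The phrase
  ``removing \<open>i\<close> does not modify the solution'' is therefore read as ``the problem without
  \<open>i\<close> has a unique solution, and it is the original one''. This makes a difference only if
  \<open>I = {i}\<close> and the unconstrained problem fails to have a unique solution, in which case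
  \<open>i\<close> is of support.\<close>

definition support_set ::
  "('a::real_inner \<Rightarrow> 'a) \<Rightarrow> ('d \<Rightarrow> 'a set) \<Rightarrow> nat set \<Rightarrow> (nat \<Rightarrow> 'd) \<Rightarrow> nat set" where
  "support_set F X I \<omega> =
     {i \<in> I. \<not> VI_unique_sol F (feasible_set X (I - {i}) \<omega>) (xstar F X I \<omega>)}"

definition nondegenerate ::
  "('a::real_inner \<Rightarrow> 'a) \<Rightarrow> ('d \<Rightarrow> 'a set) \<Rightarrow> nat set \<Rightarrow> (nat \<Rightarrow> 'd) \<Rightarrow> bool" where
  "nondegenerate F X I \<omega> \<longleftrightarrow>
     VI_unique_sol F (feasible_set X (support_set F X I \<omega>) \<omega>) (xstar F X I \<omega>)"

definition risk :: "'d measure \<Rightarrow> ('d \<Rightarrow> 'a set) \<Rightarrow> 'a \<Rightarrow> real" where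
  "risk M X x = measure M {\<delta> \<in> space M. x \<notin> X \<delta>}"

definition scen_t :: "nat \<Rightarrow> real \<Rightarrow> nat \<Rightarrow> real" where
  "scen_t N \<beta> k =
     (if k < N then
        (THE t. 0 < t \<and> t < 1 \<and>
           \<beta> / (real N + 1) * (\<Sum>l=k..N. real (l choose k) * t ^ (l - k))
             - real (N choose k) * t ^ (N - k) = 0)
      else 0)"

definition scen_eps :: "nat \<Rightarrow> real \<Rightarrow> nat \<Rightarrow> real" where
  "scen_eps N \<beta> k = 1 - scen_t N \<beta> k"

end

theory Submission
  imports Defs
begin

text \<open>
  Call a set \<open>J\<close> of samples irredundant if all of its constraints are of support for the problem
  posed on \<open>J\<close> alone. For a set \<open>K \<supseteq> J\<close> of samples, conditionally on the samples in \<open>J\<close>,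
  the solution for \<open>J\<close> satisfies the remaining constraints of \<open>K\<close> with probability
  \<open>(1 - V)\<^sup>m\<close>, where \<open>m = card (K - J)\<close> and \<open>V\<close> is the risk of that solution. For fixed \<open>K\<close> these
  events (with \<open>V < 1\<close>) are almost surely disjoint: two of them occurring together would, with
  positive conditional probability, persist when the samples outside \<open>K\<close> are added, contradicting
  non-degeneracy. This gives, for every \<open>K \<subseteq> {1..N}\<close>, an inequality
  \<open>(\<Sum>J\<subseteq>K. E ((1 - V\<^sub>J) ^ card (K - J); J irredundant, V\<^sub>J < 1)) \<le> 1\<close>.
  Adding these up with weight \<open>\<beta> / ((N + 1) (N choose card K))\<close>, whose total is \<open>\<beta>\<close>,
  bounds the probability of \<open>V > \<epsilon>(s)\<close>, because the defining polynomial of \<open>t(k)\<close> is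
  nonnegative on \<open>[0, t(k)]\<close>.

  Part (ii) follows from Helly's theorem, applied to the support constraints together with the
  half-space \<open>F(x) \<bullet> (y - x) < 0\<close>, and from the monotonicity of \<open>\<epsilon>\<close>, which holds since
  the polynomial of \<open>k\<close> has derivative \<open>k + 1\<close> times the one of \<open>k + 1\<close>.
\<close>

section \<open>The threshold polynomial\<close>

definition scen_poly :: "nat \<Rightarrow> real \<Rightarrow> nat \<Rightarrow> real \<Rightarrow> real" where
  "scen_poly N \<beta> k t =
     \<beta> / (real N + 1) * (\<Sum>l=k..N. real (l choose k) * t ^ (l - k))
       - real (N choose k) * t ^ (N - k)"

lemma scen_poly_0:
  assumes "k < N"
  shows "scen_poly N \<beta> k 0 = \<beta> / (real N + 1)"
proof -
  have "(\<Sum>l=k..N. real (l choose k) * 0 ^ (l - k)) = (\<Sum>l\<in>{k}. real (l choose k) * 0 ^ (l - k))"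
    using assms by (intro sum.mono_neutral_right) auto
  then show ?thesis
    using assms by (simp add: scen_poly_def)
qed

text \<open>By the hockey-stick identity the sum at 1 is \<open>Suc N choose Suc k\<close>, that is,
  (N + 1) / (k + 1) times \<open>N choose k\<close>. The value is therefore at most (\<beta> - 1)
  times \<open>N choose k\<close>.\<close>

lemma scen_poly_1_neg:
  assumes "0 < \<beta>" "\<beta> < 1" "k \<le> N"
  shows "scen_poly N \<beta> k 1 < 0"
proof -
  have "(\<Sum>l=k..N. l choose k) = (\<Sum>l\<le>N. l choose k)"
    by (intro sum.mono_neutral_left) auto
  then have sum: "(\<Sum>l=k..N. l choose k) = Suc N choose Suc k"
    by (simp only: sum_choose_upper)
  have "Suc k * (Suc N choose Suc k) = Suc N * (N choose k)"
    using Suc_times_binomial_eq by (simp add: mult.commute)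
  then have "(Suc N choose Suc k) \<le> Suc N * (N choose k)"
    by (metis le_add1 mult_Suc)
  then have "real (Suc N choose Suc k) \<le> (real N + 1) * real (N choose k)"
    by (metis of_nat_Suc of_nat_le_iff of_nat_mult add.commute)
  then have "\<beta> / (real N + 1) * real (Suc N choose Suc k)
      \<le> \<beta> / (real N + 1) * ((real N + 1) * real (N choose k))"
    using assms by (intro mult_left_mono) auto
  also have "\<dots> = \<beta> * real (N choose k)"
    by (simp add: field_simps)
  also have "\<dots> < real (N choose k)"
    using assms by simp
  finally show ?thesis
    unfolding scen_poly_def using sum by (simp flip: of_nat_sum)
qed

text \<open>Divided by \<open>t ^ (N - k)\<close>, the polynomial becomes a sum of nonnegative
  multiples of nonpositive powers of \<open>t\<close> minus a constant, which is strictly decreasing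
  for positive \<open>t\<close>. It can thus change sign only once.\<close>

lemma scen_poly_neg_propagates:
  assumes "0 < \<beta>" "k < N" "0 < t" "t < s" "scen_poly N \<beta> k t \<le> 0"
  shows "scen_poly N \<beta> k s < 0"
proof -
  \<comment> \<open>Scaling the value at \<open>s\<close> by \<open>r ^ (N - k)\<close> reproduces
    the subtracted term at \<open>t\<close> exactly, so that only the two sums have to be
    compared.\<close>
  define r where "r = t / s"
  have r: "0 < r" "r < 1" "r * s = t"
    using assms by (auto simp: r_def)
  have "(\<Sum>l=k..N. real (l choose k) * (r ^ (N - k) * s ^ (l - k)))
      < (\<Sum>l=k..N. real (l choose k) * t ^ (l - k))"
  proof (rule sum_strict_mono_ex1)
    show "\<forall>l\<in>{k..N}. real (l choose k) * (r ^ (N - k) * s ^ (l - k))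
        \<le> real (l choose k) * t ^ (l - k)"
    proof
      fix l assume "l \<in> {k..N}"
      then have "r ^ (N - k) \<le> r ^ (l - k)"
        using r by (intro power_decreasing) auto
      then have "r ^ (N - k) * s ^ (l - k) \<le> r ^ (l - k) * s ^ (l - k)"
        using assms by (intro mult_right_mono) auto
      also have "\<dots> = t ^ (l - k)"
        using r by (metis power_mult_distrib)
      finally show "real (l choose k) * (r ^ (N - k) * s ^ (l - k))
          \<le> real (l choose k) * t ^ (l - k)"
        by (intro mult_left_mono) auto
    qed
    \<comment> \<open>The constant term \<open>l = k\<close> is strictly smaller because
      \<open>r < 1\<close> and \<open>k < N\<close>.\<close>
    show "\<exists>l\<in>{k..N}. real (l choose k) * (r ^ (N - k) * s ^ (l - k))
        < real (l choose k) * t ^ (l - k)"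
      using assms r by (intro bexI[of _ k]) (auto simp: power_less_one_iff)
  qed auto
  then have *: "\<beta> / (real N + 1) * (\<Sum>l=k..N. real (l choose k) * (r ^ (N - k) * s ^ (l - k)))
      < \<beta> / (real N + 1) * (\<Sum>l=k..N. real (l choose k) * t ^ (l - k))"
    using assms by (intro mult_strict_left_mono) auto
  have "r ^ (N - k) * scen_poly N \<beta> k s
      = \<beta> / (real N + 1) * (\<Sum>l=k..N. real (l choose k) * (r ^ (N - k) * s ^ (l - k)))
        - real (N choose k) * t ^ (N - k)"
    unfolding scen_poly_def r(3)[symmetric]
    by (simp add: sum_distrib_left algebra_simps power_mult_distrib)
  also have "\<dots> < scen_poly N \<beta> k t"
    using * unfolding scen_poly_def by simp
  finally have "r ^ (N - k) * scen_poly N \<beta> k s < 0"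
    using assms by linarith
  then show ?thesis
    using r by (simp add: mult_less_0_iff)
qed

text \<open>The signs at 0 and 1 give a root by the intermediate value theorem, and sign propagation
  makes it unique. This discharges the definite description in \<open>scen_t\<close>.\<close>

lemma scen_t_root:
  assumes "0 < \<beta>" "\<beta> < 1" "k < N"
  shows "0 < scen_t N \<beta> k" "scen_t N \<beta> k < 1" "scen_poly N \<beta> k (scen_t N \<beta> k) = 0"
proof -
  have "continuous_on {0..1} (scen_poly N \<beta> k)"
    unfolding scen_poly_def by (intro continuous_intros)
  moreover have pos: "scen_poly N \<beta> k 0 > 0"
    using assms by (simp add: scen_poly_0)
  moreover have neg: "scen_poly N \<beta> k 1 < 0"
    using assms by (intro scen_poly_1_neg) auto
  ultimately obtain t where t: "0 \<le> t" "t \<le> 1" "scen_poly N \<beta> k t = 0"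
    using IVT2'[of "scen_poly N \<beta> k" 1 0 0] by auto
  then have t01: "0 < t" "t < 1"
    using pos neg by (auto simp: less_le)
  have "s = t" if "0 < s" "s < 1" "scen_poly N \<beta> k s = 0" for s
    using scen_poly_neg_propagates[of \<beta> k N s t] scen_poly_neg_propagates[of \<beta> k N t s]
      assms t t01 that by (cases s t rule: linorder_cases) auto
  then have "\<exists>!t. 0 < t \<and> t < 1 \<and> scen_poly N \<beta> k t = 0"
    using t t01 by blast
  from theI'[OF this] show "0 < scen_t N \<beta> k" "scen_t N \<beta> k < 1"
    "scen_poly N \<beta> k (scen_t N \<beta> k) = 0"
    using assms unfolding scen_t_def scen_poly_def by auto
qed

text \<open>A negative value to the left of the root would propagate to the root itself.\<close>

lemma scen_poly_nonneg:
  assumes "0 < \<beta>" "\<beta> < 1" "k < N" "0 \<le> x" "x \<le> scen_t N \<beta> k"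
  shows "0 \<le> scen_poly N \<beta> k x"
proof (rule ccontr)
  assume neg: "\<not> 0 \<le> scen_poly N \<beta> k x"
  with assms have "x \<noteq> 0" "x \<noteq> scen_t N \<beta> k"
    using scen_poly_0[of k N \<beta>] scen_t_root[of \<beta> k N] by auto
  with neg assms scen_poly_neg_propagates[of \<beta> k N x "scen_t N \<beta> k"] scen_t_root[of \<beta> k N]
  show False by auto
qed

text \<open>The identity \<open>(l choose k) * (l - k) = Suc k * (l choose Suc k)\<close> rewrites
  every coefficient of the derivative; the summand \<open>l = k\<close> drops out.\<close>

lemma scen_poly_has_derivative:
  assumes "Suc k < N"
  shows "(scen_poly N \<beta> k has_real_derivative real (Suc k) * scen_poly N \<beta> (Suc k) t) (at t)"
proof -
  have coeff: "real (l choose k) * real (l - k) = real (Suc k) * real (l choose Suc k)" for l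
    by (metis binomial_absorb_comp binomial_absorption mult.commute of_nat_mult diff_Suc_1)
  have "(\<Sum>l=k..N. real (l choose k) * (real (l - k) * t ^ (l - k - 1)))
      = (\<Sum>l=Suc k..N. real (l choose k) * (real (l - k) * t ^ (l - k - 1)))"
    using assms by (intro sum.mono_neutral_right) (auto simp: not_less_eq_eq)
  also have "\<dots> = real (Suc k) * (\<Sum>l=Suc k..N. real (l choose Suc k) * t ^ (l - Suc k))"
    unfolding sum_distrib_left
  proof (intro sum.cong refl)
    fix l
    show "real (l choose k) * (real (l - k) * t ^ (l - k - 1))
        = real (Suc k) * (real (l choose Suc k) * t ^ (l - Suc k))"
      using coeff[of l] by (simp only: mult.assoc[symmetric]) simp
  qed
  finally have sum: "(\<Sum>l=k..N. real (l choose k) * (real (l - k) * t ^ (l - k - 1)))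
    = real (Suc k) * (\<Sum>l=Suc k..N. real (l choose Suc k) * t ^ (l - Suc k))" .
  have "(scen_poly N \<beta> k has_real_derivative
      \<beta> / (real N + 1) * (\<Sum>l=k..N. real (l choose k) * (real (l - k) * t ^ (l - k - 1)))
      - real (N choose k) * (real (N - k) * t ^ (N - k - 1))) (at t)"
    unfolding scen_poly_def by (auto intro!: derivative_eq_intros sum.cong)
  moreover have "real (N choose k) * (real (N - k) * t ^ (N - k - 1))
      = real (Suc k) * (real (N choose Suc k) * t ^ (N - Suc k))"
    using coeff[of N] by (simp only: mult.assoc[symmetric]) simp
  ultimately show ?thesis
    unfolding sum by (simp only: scen_poly_def[of N \<beta> "Suc k"] right_diff_distrib mult.left_commute)
qed

text \<open>If the root for \<open>Suc k\<close> were larger, the derivative of the polynomial of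
  \<open>k\<close> would be nonnegative up to the root for \<open>k\<close>. The polynomial could
  then not descend from its positive value at 0 to 0.\<close>

lemma scen_t_Suc_le:
  assumes "0 < \<beta>" "\<beta> < 1"
  shows "scen_t N \<beta> (Suc k) \<le> scen_t N \<beta> k"
proof (cases "Suc k < N")
  case True
  show ?thesis
  proof (rule ccontr)
    assume less: "\<not> ?thesis"
    note t = scen_t_root[of \<beta> k N]
    have "0 < scen_t N \<beta> k"
      using t assms True by auto
    with MVT2[of 0 "scen_t N \<beta> k" "scen_poly N \<beta> k" "\<lambda>t. real (Suc k) * scen_poly N \<beta> (Suc k) t"]
    obtain z where z: "0 < z" "z < scen_t N \<beta> k"
      "scen_poly N \<beta> k (scen_t N \<beta> k) - scen_poly N \<beta> k 0
        = (scen_t N \<beta> k - 0) * (real (Suc k) * scen_poly N \<beta> (Suc k) z)"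
      using scen_poly_has_derivative[OF True] by blast
    have "0 \<le> scen_poly N \<beta> (Suc k) z"
      using assms True z less by (intro scen_poly_nonneg) auto
    then have "0 \<le> scen_poly N \<beta> k (scen_t N \<beta> k) - scen_poly N \<beta> k 0"
      unfolding z(3) using z by auto
    moreover have "scen_poly N \<beta> k (scen_t N \<beta> k) = 0"
      using t assms True by auto
    moreover have "0 < scen_poly N \<beta> k 0"
      using assms True by (simp add: scen_poly_0)
    ultimately show False
      by linarith
  qed
next
  case False
  then have "scen_t N \<beta> (Suc k) = 0"
    by (simp add: scen_t_def)
  moreover have "0 \<le> scen_t N \<beta> k"
    using scen_t_root(1)[OF assms, of k N] by (cases "k < N") (auto simp: scen_t_def)
  ultimately show ?thesis by simp
qed

lemma scen_eps_mono:
  assumes "0 < \<beta>" "\<beta> < 1" "j \<le> k"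
  shows "scen_eps N \<beta> j \<le> scen_eps N \<beta> k"
  using lift_Suc_antimono_le[of "scen_t N \<beta>" j k] scen_t_Suc_le assms
  by (simp add: scen_eps_def)

section \<open>Weighted sums over subsets\<close>

lemma sum_Pow_card:
  fixes h :: "nat \<Rightarrow> real"
  assumes "finite A"
  shows "(\<Sum>L\<in>Pow A. h (card L)) = (\<Sum>l\<le>card A. real (card A choose l) * h l)"
proof -
  have "(\<Sum>L\<in>Pow A. h (card L)) = (\<Sum>l\<le>card A. \<Sum>L\<in>{L \<in> Pow A. card L = l}. h (card L))"
    using assms by (intro sum.group[symmetric]) (auto intro: card_mono)
  also have "\<dots> = (\<Sum>l\<le>card A. real (card A choose l) * h l)"
  proof (intro sum.cong refl)
    fix l
    have "card {L \<in> Pow A. card L = l} = card A choose l"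
      using n_subsets[OF assms] by simp
    then show "(\<Sum>L\<in>{L \<in> Pow A. card L = l}. h (card L)) = real (card A choose l) * h l"
      by simp
  qed
  finally show ?thesis .
qed

text \<open>Removing \<open>J\<close> maps the supersets of \<open>J\<close> within \<open>I\<close>
  bijectively onto the subsets of \<open>I - J\<close>.\<close>

lemma sum_supersets_card:
  fixes h :: "nat \<Rightarrow> real"
  assumes "finite I" "J \<subseteq> I"
  shows "(\<Sum>K\<in>{K \<in> Pow I. J \<subseteq> K}. h (card (K - J)))
       = (\<Sum>l\<le>card (I - J). real (card (I - J) choose l) * h l)"
proof -
  have "(\<Sum>K\<in>{K \<in> Pow I. J \<subseteq> K}. h (card (K - J))) = (\<Sum>L\<in>Pow (I - J). h (card L))"
    using assms by (intro sum.reindex_bij_witness[of _ "\<lambda>L. L \<union> J" "\<lambda>K. K - J"])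
      (auto intro: arg_cong[where f = "\<lambda>L. h (card L)"])
  also have "\<dots> = (\<Sum>l\<le>card (I - J). real (card (I - J) choose l) * h l)"
    using assms by (intro sum_Pow_card) auto
  finally show ?thesis .
qed

text \<open>Each cardinality from 0 to \<open>N\<close> receives the same total weight \<beta> / (N
  + 1), spread evenly over the sets of that size.\<close>

definition subset_weight :: "nat \<Rightarrow> real \<Rightarrow> nat \<Rightarrow> real" where
  "subset_weight N \<beta> m = \<beta> / (real N + 1) / real (N choose m)"

lemma sum_subset_weight:
  assumes "finite I"
  shows "(\<Sum>K\<in>Pow I. subset_weight (card I) \<beta> (card K)) = \<beta>"
proof -
  have "(\<Sum>K\<in>Pow I. subset_weight (card I) \<beta> (card K))
      = (\<Sum>l\<le>card I. real (card I choose l) * subset_weight (card I) \<beta> l)"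
    using assms by (rule sum_Pow_card)
  also have "\<dots> = (\<Sum>l\<le>card I. \<beta> / (real (card I) + 1))"
    by (intro sum.cong) (auto simp: subset_weight_def)
  also have "\<dots> = \<beta>"
    by (simp add: field_simps)
  finally show ?thesis .
qed

text \<open>Here the polynomial of \<open>k\<close> arises: since \<open>(N choose l) * (l choose k)
  = (N choose k) * (N - k choose (l - k))\<close>, the weights of the supersets of size
  \<open>l\<close> add up to its coefficient, divided by \<open>N choose k\<close>.\<close>

lemma sum_supersets_weight:
  assumes "finite I" "J \<subseteq> I"
  defines "N \<equiv> card I" and "k \<equiv> card J"
  shows "(\<Sum>K\<in>{K \<in> Pow I. J \<subseteq> K}. subset_weight N \<beta> (card K) * x ^ card (K - J))
    = \<beta> / (real N + 1) * (\<Sum>l=k..N. real (l choose k) * x ^ (l - k)) / real (N choose k)"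
proof -
  have J: "finite J" and kN: "k \<le> N"
    using assms by (auto intro: finite_subset card_mono)
  have card_diff: "card (I - J) = N - k"
    using assms J by (simp add: card_Diff_subset)
  have "(\<Sum>K\<in>{K \<in> Pow I. J \<subseteq> K}. subset_weight N \<beta> (card K) * x ^ card (K - J))
      = (\<Sum>K\<in>{K \<in> Pow I. J \<subseteq> K}. subset_weight N \<beta> (k + card (K - J)) * x ^ card (K - J))"
  proof (intro sum.cong refl)
    fix K assume "K \<in> {K \<in> Pow I. J \<subseteq> K}"
    then have "card K = k + card (K - J)"
      using assms(1) J card_mono[of K J] by (auto simp: k_def card_Diff_subset dest: finite_subset)
    then show "subset_weight N \<beta> (card K) * x ^ card (K - J)
        = subset_weight N \<beta> (k + card (K - J)) * x ^ card (K - J)"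
      by simp
  qed
  also have "\<dots> = (\<Sum>l\<le>N - k. real (N - k choose l) * (subset_weight N \<beta> (k + l) * x ^ l))"
    using sum_supersets_card[OF assms(1,2), of "\<lambda>l. subset_weight N \<beta> (k + l) * x ^ l"]
    by (simp add: card_diff)
  also have "\<dots> = (\<Sum>l=k..N. real (N - k choose (l - k)) * (subset_weight N \<beta> l * x ^ (l - k)))"
    using kN by (intro sum.reindex_bij_witness[of _ "\<lambda>l. l - k" "\<lambda>l. k + l"]) auto
  also have "\<dots> = (\<Sum>l=k..N. \<beta> / (real N + 1) * (real (l choose k) * x ^ (l - k)) / real (N choose k))"
  proof (intro sum.cong refl)
    fix l assume l: "l \<in> {k..N}"
    then have "real (N choose l) * real (l choose k) = real (N choose k) * real (N - k choose (l - k))"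
      using choose_mult[of k l N] by (metis atLeastAtMost_iff of_nat_mult)
    moreover have "real (N choose l) > 0" "real (N choose k) > 0"
      using l by auto
    ultimately have "real (N - k choose (l - k)) / real (N choose l) = real (l choose k) / real (N choose k)"
      by (simp add: frac_eq_eq mult.commute)
    moreover have "real (N - k choose (l - k)) * (subset_weight N \<beta> l * x ^ (l - k))
        = \<beta> / (real N + 1) * (real (N - k choose (l - k)) / real (N choose l)) * x ^ (l - k)"
      by (simp add: subset_weight_def)
    ultimately show "real (N - k choose (l - k)) * (subset_weight N \<beta> l * x ^ (l - k))
        = \<beta> / (real N + 1) * (real (l choose k) * x ^ (l - k)) / real (N choose k)"
      by simp
  qed
  also have "\<dots> = \<beta> / (real N + 1) * (\<Sum>l=k..N. real (l choose k) * x ^ (l - k)) / real (N choose k)"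
    by (simp add: sum_distrib_left sum_divide_distrib)
  finally show ?thesis .
qed

text \<open>For positive \<open>x\<close> this is \<open>scen_poly_nonneg\<close> divided by the
  binomial coefficient. For \<open>x = 0\<close> both sides vanish, the left one because
  \<open>J\<close> is a proper subset of \<open>I\<close>. Later \<open>x\<close> is one minus the
  risk of the solution for \<open>J\<close>.\<close>

lemma power_le_sum_supersets_weight:
  assumes "finite I" "J \<subseteq> I" "0 < \<beta>" "\<beta> < 1" "0 \<le> x" "x < scen_t (card I) \<beta> (card J)"
  shows "x ^ card (I - J)
    \<le> (\<Sum>K\<in>{K \<in> Pow I. J \<subseteq> K}. subset_weight (card I) \<beta> (card K) * (of_bool (0 < x) * x ^ card (K - J)))"
proof -
  \<comment> \<open>From \<open>card I\<close> on, \<open>scen_t\<close> is 0, which would force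
    \<open>x < 0\<close>.\<close>
  have less: "card J < card I"
  proof (rule ccontr)
    assume "\<not> card J < card I"
    with assms show False
      by (simp add: scen_t_def)
  qed
  have J: "finite J"
    using assms by (auto intro: finite_subset)
  show ?thesis
  proof (cases "x = 0")
    case True
    then show ?thesis
      using less J by (simp add: card_Diff_subset[OF J assms(2)] zero_power)
  next
    case False
    have "0 \<le> scen_poly (card I) \<beta> (card J) x"
      using assms less by (intro scen_poly_nonneg) auto
    then have "x ^ (card I - card J) \<le> \<beta> / (real (card I) + 1)
        * (\<Sum>l=card J..card I. real (l choose card J) * x ^ (l - card J)) / real (card I choose card J)"
      using less by (subst pos_le_divide_eq) (auto simp: scen_poly_def mult.commute)
    then show ?thesis
      unfolding sum_supersets_weight[OF assms(1,2), symmetric]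
      using False assms by (simp add: card_Diff_subset[OF J assms(2)])
  qed
qed

section \<open>Variational inequalities and their support constraints\<close>

text \<open>Each support constraint \<open>i\<close> has a witness \<open>y i\<close> that satisfies
  all the other constraints and lies in the half-space \<open>H\<close>. The point \<open>x\<close>
  serves subfamilies without \<open>H\<close>, and \<open>y i\<close> serves those without
  \<open>A i\<close>; Helly's theorem would then yield a feasible point in \<open>H\<close>.\<close>

lemma card_VI_support_le_DIM:
  fixes F :: "'a::euclidean_space \<Rightarrow> 'a" and C :: "'i \<Rightarrow> 'a set"
  assumes fin: "finite S" and S: "S \<subseteq> I" and conv: "\<And>i. i \<in> I \<Longrightarrow> convex (C i)"
    and x: "VI_sol F (\<Inter>i\<in>I. C i) x"
    and supp: "\<And>i. i \<in> S \<Longrightarrow> \<not> VI_sol F (\<Inter>j\<in>I - {i}. C j) x"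
  shows "card S \<le> DIM('a)"
proof (rule ccontr)
  assume "\<not> ?thesis"
  then have card: "DIM('a) + 1 \<le> card S" by simp
  have xC: "x \<in> C i" if "i \<in> I" for i
    using x that by (auto simp: VI_sol_def)
  have "\<exists>y. (\<forall>j\<in>I - {i}. y \<in> C j) \<and> F x \<bullet> (y - x) < 0" if "i \<in> S" for i
    using supp[OF that] xC by (auto simp: VI_sol_def not_le)
  then obtain y where y: "\<And>i j. i \<in> S \<Longrightarrow> j \<in> I - {i} \<Longrightarrow> y i \<in> C j"
    "\<And>i. i \<in> S \<Longrightarrow> F x \<bullet> (y i - x) < 0"
    by metis
  have none: "\<not> (F x \<bullet> (z - x) < 0 \<and> (\<forall>i\<in>I. z \<in> C i))" for z
    using x by (auto simp: VI_sol_def not_less)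
  define H where "H = {z. F x \<bullet> (z - x) < 0}"
  \<comment> \<open>The constraints outside \<open>S\<close> are put into every \<open>A i\<close>,
    so the intersection over the nonempty set \<open>S\<close> is the whole feasible set.\<close>
  define A where "A i = C i \<inter> (\<Inter>j\<in>I - S. C j)" for i
  have xA: "x \<in> A i" if "i \<in> S" for i
    using that xC S by (auto simp: A_def)
  have yA: "y i \<in> A j" if "i \<in> S" "j \<in> S" "i \<noteq> j" for i j
    using that y(1) S by (auto simp: A_def)
  have y_notin: "y i \<notin> A i" if "i \<in> S" for i
    using none[of "y i"] y[OF that] by (auto simp: A_def)
  \<comment> \<open>Helly's theorem counts distinct sets, so different indices must give different
    \<open>A i\<close>.\<close>
  have "inj_on A S"
    using yA y_notin by (metis inj_onI)
  then have "card (A ` S) = card S"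
    by (rule card_image)
  moreover have "x \<notin> H"
    by (simp add: H_def)
  then have "H \<notin> A ` S"
    using xA by blast
  ultimately have card_fam: "card (insert H (A ` S)) = card S + 1"
    using fin by simp
  have "\<Inter> (insert H (A ` S)) \<noteq> {}"
  proof (rule Helly)
    show "DIM('a) + 1 \<le> card (insert H (A ` S))"
      using card card_fam by simp
    have "H = {z. F x \<bullet> z < F x \<bullet> x}"
      by (simp add: H_def inner_diff_right)
    then have "convex H"
      by (simp add: convex_halfspace_lt)
    moreover have "convex (A i)" if "i \<in> S" for i
      using that S conv by (auto simp: A_def intro!: convex_Int convex_INT)
    ultimately show "\<forall>s\<in>insert H (A ` S). convex s"
      by auto
  next
    fix t assume t: "t \<subseteq> insert H (A ` S)" "card t = DIM('a) + 1"
    \<comment> \<open>The family has at least \<open>DIM('a) + 2\<close> members, so a subfamily of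
      size \<open>DIM('a) + 1\<close> misses one of them.\<close>
    then have "t \<noteq> insert H (A ` S)"
      using card card_fam by auto
    with t obtain B where B: "B \<in> insert H (A ` S)" "B \<notin> t"
      by blast
    show "\<Inter> t \<noteq> {}"
    proof (cases "B = H")
      case True
      with B t have "t \<subseteq> A ` S"
        by auto
      with xA have "x \<in> \<Inter> t"
        by auto
      then show ?thesis
        by auto
    next
      case False
      with B obtain i where i: "i \<in> S" "B = A i"
        by auto
      have "y i \<in> D" if "D \<in> t" for D
        using that t(1) B(2) i y(2)[OF i(1)] yA[OF i(1)] by (auto simp: H_def)
      then show ?thesis
        by auto
    qed
  qed
  then obtain z where "z \<in> H" "\<And>i. i \<in> S \<Longrightarrow> z \<in> A i"
    by auto
  moreover have "S \<noteq> {}"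
    using card by auto
  ultimately have "z \<in> C i" if "i \<in> I" for i
    using that by (cases "i \<in> S") (auto simp: A_def)
  with none[of z] \<open>z \<in> H\<close> show False
    by (auto simp: H_def)
qed

section \<open>Comparing subproblems and their dependence on the samples\<close>

lemma VI_sol_subset: "VI_sol F K x \<Longrightarrow> L \<subseteq> K \<Longrightarrow> x \<in> L \<Longrightarrow> VI_sol F L x"
  by (auto simp: VI_sol_def)

text \<open>A solution on the larger set that lies in the smaller one still solves the problem
  there, so it must be the unique solution \<open>y\<close>. This is how solutions of different
  subproblems get identified.\<close>

lemma VI_unique_sol_subset:
  "VI_unique_sol F L y \<Longrightarrow> VI_sol F K x \<Longrightarrow> L \<subseteq> K \<Longrightarrow> x \<in> L \<Longrightarrow> VI_unique_sol F L x"
  using VI_sol_subset[of F K x L] by (auto simp: VI_unique_sol_def)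

lemma xstar_eqI: "VI_unique_sol F (feasible_set X J \<omega>) x \<Longrightarrow> xstar F X J \<omega> = x"
  unfolding xstar_def VI_unique_sol_def by (rule the_equality) auto

lemma feasible_set_antimono: "J \<subseteq> K \<Longrightarrow> feasible_set X K \<omega> \<subseteq> feasible_set X J \<omega>"
  by (auto simp: feasible_set_def)

text \<open>Independence of the samples outside \<open>J\<close>, here and for the other notions
  below, is what allows these samples to be integrated out.\<close>

lemma feasible_set_upd: "i \<notin> J \<Longrightarrow> feasible_set X J (\<omega> (i := y)) = feasible_set X J \<omega>"
  unfolding feasible_set_def by (intro INF_cong) auto

lemma xstar_upd: "i \<notin> J \<Longrightarrow> xstar F X J (\<omega> (i := y)) = xstar F X J \<omega>"
  by (simp add: xstar_def feasible_set_upd)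

lemma support_set_subset: "support_set F X J \<omega> \<subseteq> J"
  by (auto simp: support_set_def)

lemma support_set_upd: "i \<notin> J \<Longrightarrow> support_set F X J (\<omega> (i := y)) = support_set F X J \<omega>"
  by (simp add: support_set_def xstar_upd feasible_set_upd)

text \<open>Unique solvability is demanded explicitly on account of \<open>J = {}\<close>, where the
  unconstrained problem may lack it.\<close>

definition irredundant ::
  "('a::real_inner \<Rightarrow> 'a) \<Rightarrow> ('d \<Rightarrow> 'a set) \<Rightarrow> nat set \<Rightarrow> (nat \<Rightarrow> 'd) \<Rightarrow> bool" where
  "irredundant F X J \<omega> \<longleftrightarrow>
     VI_unique_sol F (feasible_set X J \<omega>) (xstar F X J \<omega>) \<and> support_set F X J \<omega> = J"

lemma irredundant_upd: "i \<notin> J \<Longrightarrow> irredundant F X J (\<omega> (i := y)) = irredundant F X J \<omega>"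
  by (simp add: irredundant_def xstar_upd feasible_set_upd support_set_upd)

lemma borel_measurable_of_bool:
  "Measurable.pred S P \<Longrightarrow> (\<lambda>x. of_bool (P x) :: real) \<in> borel_measurable S"
  unfolding of_bool_def by measurable

lemma abs_mult_le_1:
  fixes a b :: real
  assumes "\<bar>a\<bar> \<le> 1" "0 \<le> b" "b \<le> 1"
  shows "\<bar>a * b\<bar> \<le> 1"
  using mult_mono[OF assms(1) assms(3)] assms by (simp add: abs_mult)

text \<open>The assumptions range over all sample sizes \<open>m\<close> because the argument passes
  to subproblems. Non-degeneracy concerns one fixed index set and is added where it is used.\<close>

locale VI_scenario = prob_space M
  for M :: "'d measure" +
  fixes F :: "'a::real_inner \<Rightarrow> 'a" and X :: "'d \<Rightarrow> 'a set"
  assumes exists_unique: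
      "\<And>m \<omega>. m \<ge> 1 \<Longrightarrow> \<omega> \<in> space (Pi\<^sub>M {1..m} (\<lambda>_. M)) \<Longrightarrow>
         \<exists>!x. VI_sol F (feasible_set X {1..m} \<omega>) x"
    and meas_constraint:
      "\<And>x. {\<delta> \<in> space M. x \<in> X \<delta>} \<in> sets M"
    and meas_violation:
      "\<And>m. m \<ge> 1 \<Longrightarrow>
         {p \<in> space (Pi\<^sub>M {1..m} (\<lambda>_. M) \<Otimes>\<^sub>M M). xstar F X {1..m} (fst p) \<in> X (snd p)}
           \<in> sets (Pi\<^sub>M {1..m} (\<lambda>_. M) \<Otimes>\<^sub>M M)"
begin

abbreviation samples :: "nat set \<Rightarrow> (nat \<Rightarrow> 'd) measure" where
  "samples I \<equiv> Pi\<^sub>M I (\<lambda>_. M)"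

sublocale samples: product_prob_space "\<lambda>_. M" I for I :: "nat set" ..

abbreviation sol :: "nat set \<Rightarrow> (nat \<Rightarrow> 'd) \<Rightarrow> 'a" where
  "sol \<equiv> xstar F X"

definition accept_prob :: "nat set \<Rightarrow> (nat \<Rightarrow> 'd) \<Rightarrow> real" where
  "accept_prob J \<omega> = measure M {\<delta> \<in> space M. sol J \<omega> \<in> X \<delta>}"

lemma risk_eq: "risk M X (sol J \<omega>) = 1 - accept_prob J \<omega>"
proof -
  have "{\<delta> \<in> space M. sol J \<omega> \<notin> X \<delta>} = space M - {\<delta> \<in> space M. sol J \<omega> \<in> X \<delta>}"
    by auto
  then show ?thesis
    unfolding risk_def accept_prob_def using prob_compl[OF meas_constraint] by simp
qed

lemma accept_prob_bounds: "0 \<le> accept_prob J \<omega>" "accept_prob J \<omega> \<le> 1"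
  by (simp_all add: accept_prob_def)

lemma accept_prob_upd: "i \<notin> J \<Longrightarrow> accept_prob J (\<omega> (i := y)) = accept_prob J \<omega>"
  by (simp add: accept_prob_def xstar_upd)

text \<open>The assumptions speak of index sets \<open>{1..m}\<close> only; a bijection carries them
  over to any nonempty finite \<open>J\<close>.\<close>

lemma reindex:
  assumes "finite J" "J \<noteq> {}"
  obtains f :: "nat \<Rightarrow> nat" and m where "m \<ge> 1" "f ` {1..m} = J"
    "\<And>\<omega>. feasible_set X J \<omega> = feasible_set X {1..m} (\<lambda>j\<in>{1..m}. \<omega> (f j))"
    "\<And>\<omega>. sol J \<omega> = sol {1..m} (\<lambda>j\<in>{1..m}. \<omega> (f j))"
proof -
  define m where "m = card J"
  obtain f where "bij_betw f {1..m} J"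
    using ex_bij_betw_nat_finite_1[OF assms(1)] unfolding m_def by blast
  then have f: "J = f ` {1..m}"
    by (simp add: bij_betw_def)
  have *: "feasible_set X J \<omega> = feasible_set X {1..m} (\<lambda>j\<in>{1..m}. \<omega> (f j))" for \<omega>
    by (simp add: feasible_set_def f)
  show ?thesis
  proof
    show "1 \<le> m"
      using assms by (simp add: m_def Suc_le_eq card_gt_0_iff)
    show "sol J \<omega> = sol {1..m} (\<lambda>j\<in>{1..m}. \<omega> (f j))" for \<omega>
      using *[of \<omega>] by (simp add: xstar_def)
  qed (use * f in auto)
qed

text \<open>The problem without samples need not have a unique solution; by definition of
  \<^const>\<open>support_set\<close> the only sample of a one-sample problem is then of support.\<close>

definition solvable :: "nat set \<Rightarrow> bool" where
  "solvable J \<longleftrightarrow> J \<noteq> {} \<or> (\<exists>x. VI_unique_sol F UNIV x)"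

lemma solvableI: "VI_unique_sol F (feasible_set X J \<omega>) x \<Longrightarrow> solvable J"
  by (cases "J = {}") (auto simp: solvable_def feasible_set_def)

lemma VI_unique_sol_sol:
  assumes "finite J" "solvable J" "\<omega> \<in> J \<rightarrow> space M"
  shows "VI_unique_sol F (feasible_set X J \<omega>) (sol J \<omega>)"
proof (cases "J = {}")
  case True
  then obtain x where x: "VI_unique_sol F (feasible_set X J \<omega>) x"
    using assms by (auto simp: solvable_def feasible_set_def)
  with xstar_eqI[OF x] show ?thesis by simp
next
  case False
  with assms obtain f m where fm: "m \<ge> 1" "f ` {1..m} = J"
    "\<And>\<omega>. feasible_set X J \<omega> = feasible_set X {1..m} (\<lambda>j\<in>{1..m}. \<omega> (f j))"
    using reindex by metis
  have "(\<lambda>j\<in>{1..m}. \<omega> (f j)) \<in> space (samples {1..m})"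
    using assms(3) fm(2) by (auto simp: space_PiM)
  from exists_unique[OF fm(1) this] obtain x
    where "VI_unique_sol F (feasible_set X J \<omega>) x"
    unfolding VI_unique_sol_def fm(3)[symmetric] by blast
  with xstar_eqI[OF this] show ?thesis by simp
qed

text \<open>If the solution without \<open>i\<close> satisfies constraint \<open>i\<close>, it also
  solves the problem on \<open>J\<close>, so the two solutions agree. Support is thereby expressed
  through acceptance events, whose measurability is available.\<close>

lemma removable_iff:
  assumes "finite J" "i \<in> J" "\<omega> \<in> J \<rightarrow> space M"
  shows "VI_unique_sol F (feasible_set X (J - {i}) \<omega>) (sol J \<omega>) \<longleftrightarrow>
    solvable (J - {i}) \<and> sol (J - {i}) \<omega> \<in> X (\<omega> i)"
proof
  have J: "VI_unique_sol F (feasible_set X J \<omega>) (sol J \<omega>)"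
    using assms by (intro VI_unique_sol_sol) (auto simp: solvable_def)
  {
    assume *: "VI_unique_sol F (feasible_set X (J - {i}) \<omega>) (sol J \<omega>)"
    then have "solvable (J - {i})"
      by (rule solvableI)
    moreover have "sol J \<omega> \<in> X (\<omega> i)"
      using J assms by (auto simp: VI_unique_sol_def VI_sol_def feasible_set_def)
    ultimately show "solvable (J - {i}) \<and> sol (J - {i}) \<omega> \<in> X (\<omega> i)"
      using xstar_eqI[OF *] by simp
  }
  assume *: "solvable (J - {i}) \<and> sol (J - {i}) \<omega> \<in> X (\<omega> i)"
  then have Ji: "VI_unique_sol F (feasible_set X (J - {i}) \<omega>) (sol (J - {i}) \<omega>)"
    using assms by (intro VI_unique_sol_sol) auto
  have "feasible_set X J \<omega> = feasible_set X (J - {i}) \<omega> \<inter> X (\<omega> i)"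
    using assms(2) by (auto simp: feasible_set_def)
  then have "VI_sol F (feasible_set X J \<omega>) (sol (J - {i}) \<omega>)"
    using Ji * by (auto simp: VI_unique_sol_def VI_sol_def)
  then have "sol (J - {i}) \<omega> = sol J \<omega>"
    using J by (simp add: VI_unique_sol_def)
  with Ji show "VI_unique_sol F (feasible_set X (J - {i}) \<omega>) (sol J \<omega>)"
    by simp
qed

lemma support_set_eq:
  assumes "finite J" "\<omega> \<in> J \<rightarrow> space M"
  shows "support_set F X J \<omega> = {i \<in> J. \<not> (solvable (J - {i}) \<and> sol (J - {i}) \<omega> \<in> X (\<omega> i))}"
  using removable_iff[OF assms(1) _ assms(2)] by (auto simp: support_set_def)

lemma irredundant_iff:
  assumes "finite J" "\<omega> \<in> J \<rightarrow> space M"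
  shows "irredundant F X J \<omega> \<longleftrightarrow>
    solvable J \<and> (\<forall>i\<in>J. \<not> (solvable (J - {i}) \<and> sol (J - {i}) \<omega> \<in> X (\<omega> i)))"
  unfolding irredundant_def support_set_eq[OF assms]
  using VI_unique_sol_sol[OF assms(1) _ assms(2)] solvableI by blast

lemma sol_eq_sol_subset:
  assumes "finite I" "J \<subseteq> I" "\<omega> \<in> I \<rightarrow> space M"
    and "solvable J" "\<And>i. i \<in> I - J \<Longrightarrow> sol J \<omega> \<in> X (\<omega> i)"
  shows "sol I \<omega> = sol J \<omega>"
proof (rule xstar_eqI)
  have J: "VI_unique_sol F (feasible_set X J \<omega>) (sol J \<omega>)"
    using assms by (intro VI_unique_sol_sol) (auto intro: finite_subset)
  have I: "VI_unique_sol F (feasible_set X I \<omega>) (sol I \<omega>)"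
    using assms by (intro VI_unique_sol_sol) (auto simp: solvable_def)
  show "VI_unique_sol F (feasible_set X I \<omega>) (sol J \<omega>)"
  proof (rule VI_unique_sol_subset[OF I])
    show "VI_sol F (feasible_set X J \<omega>) (sol J \<omega>)"
      using J by (simp add: VI_unique_sol_def)
    then show "sol J \<omega> \<in> feasible_set X I \<omega>"
      using assms(5) by (fastforce simp: VI_sol_def feasible_set_def)
    show "feasible_set X I \<omega> \<subseteq> feasible_set X J \<omega>"
      using assms(2) by (rule feasible_set_antimono)
  qed
qed

text \<open>If \<open>i\<close> were removable from \<open>S\<close>, then \<open>sol I\<close>
  would already be determined by \<open>S - {i}\<close> and would satisfy all of
  \<open>I - {i}\<close>, so \<open>i\<close> would not be of support for \<open>I\<close>.\<close>

lemma support_set_nondegenerate: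
  assumes "finite I" "\<omega> \<in> I \<rightarrow> space M" "nondegenerate F X I \<omega>"
  defines "S \<equiv> support_set F X I \<omega>"
  shows "irredundant F X S \<omega>" "sol S \<omega> = sol I \<omega>" "\<And>i. i \<in> I - S \<Longrightarrow> sol S \<omega> \<in> X (\<omega> i)"
proof -
  have S: "VI_unique_sol F (feasible_set X S \<omega>) (sol I \<omega>)"
    using assms by (simp add: nondegenerate_def)
  then show sol: "sol S \<omega> = sol I \<omega>"
    by (rule xstar_eqI)
  have SI: "S \<subseteq> I"
    by (simp add: S_def support_set_subset)
  have feas: "sol I \<omega> \<in> X (\<omega> i)" if "i \<in> I" for i
    using VI_unique_sol_sol[OF assms(1) _ assms(2)] that
    by (auto simp: VI_unique_sol_def VI_sol_def feasible_set_def solvable_def)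
  then show "\<And>i. i \<in> I - S \<Longrightarrow> sol S \<omega> \<in> X (\<omega> i)"
    using sol by simp
  have "i \<in> support_set F X S \<omega>" if "i \<in> S" for i
  proof (rule ccontr)
    assume "i \<notin> support_set F X S \<omega>"
    with that have Si: "VI_unique_sol F (feasible_set X (S - {i}) \<omega>) (sol I \<omega>)"
      by (simp add: support_set_def sol)
    have sub: "feasible_set X (I - {i}) \<omega> \<subseteq> feasible_set X (S - {i}) \<omega>"
      using SI by (intro feasible_set_antimono) auto
    have mem: "sol I \<omega> \<in> feasible_set X (I - {i}) \<omega>"
      using feas by (auto simp: feasible_set_def)
    \<comment> \<open>Uniqueness is not assumed for the empty problem, but if \<open>I - {i}\<close>
      is empty then it equals \<open>S - {i}\<close>.\<close>
    have "VI_unique_sol F (feasible_set X (I - {i}) \<omega>) (sol I \<omega>)"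
    proof (cases "I - {i} = {}")
      case True
      with SI have "S - {i} = I - {i}" by auto
      with Si show ?thesis by simp
    next
      case False
      have "VI_unique_sol F (feasible_set X (I - {i}) \<omega>) (sol (I - {i}) \<omega>)"
        using assms False by (intro VI_unique_sol_sol) (auto simp: solvable_def)
      moreover have "VI_sol F (feasible_set X (S - {i}) \<omega>) (sol I \<omega>)"
        using Si by (simp add: VI_unique_sol_def)
      ultimately show ?thesis
        using sub mem by (rule VI_unique_sol_subset)
    qed
    then have "i \<notin> S"
      by (simp add: S_def support_set_def)
    with that show False by simp
  qed
  then have "support_set F X S \<omega> = S"
    using support_set_subset by blast
  with S sol show "irredundant F X S \<omega>"
    by (simp add: irredundant_def)
qed

text \<open>The solutions for \<open>J\<close> and \<open>I\<close> agree. A constraint outside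
  \<open>J\<close> can then be dropped from \<open>I\<close>, and if \<open>S\<close> omitted an
  element of \<open>J\<close>, that element could be dropped from \<open>J\<close>. Hence at most
  one irredundant set is accepted by all remaining samples.\<close>

lemma irredundant_eq_support_set:
  assumes "finite I" "J \<subseteq> I" "\<omega> \<in> I \<rightarrow> space M" "nondegenerate F X I \<omega>"
    and "irredundant F X J \<omega>" "\<And>i. i \<in> I - J \<Longrightarrow> sol J \<omega> \<in> X (\<omega> i)"
  shows "support_set F X I \<omega> = J"
proof -
  define S where "S = support_set F X I \<omega>"
  have J: "VI_unique_sol F (feasible_set X J \<omega>) (sol J \<omega>)" "support_set F X J \<omega> = J"
    using assms by (auto simp: irredundant_def)
  then have "solvable J"
    using solvableI by blast
  then have sol: "sol I \<omega> = sol J \<omega>"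
    using assms by (intro sol_eq_sol_subset) auto
  have in_feasible: "sol I \<omega> \<in> feasible_set X I \<omega>"
  proof -
    have "sol J \<omega> \<in> X (\<omega> i)" if "i \<in> I" for i
      using J(1) assms(6)[of i] that
      by (cases "i \<in> J") (auto simp: VI_unique_sol_def VI_sol_def feasible_set_def)
    then show ?thesis
      by (simp add: sol feasible_set_def)
  qed
  \<comment> \<open>A set \<open>K\<close> that determines \<open>sol I\<close> passes this on to
    every \<open>L\<close> between \<open>K\<close> and \<open>I\<close>.\<close>
  have *: "VI_unique_sol F (feasible_set X L \<omega>) (sol I \<omega>)"
    if L: "L \<subseteq> I" "K \<subseteq> L" and K: "VI_unique_sol F (feasible_set X K \<omega>) (sol I \<omega>)" for K L
  proof (cases "L = {}")
    case True
    with L K show ?thesis by simp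
  next
    case False
    then have "VI_unique_sol F (feasible_set X L \<omega>) (sol L \<omega>)"
      using assms L by (intro VI_unique_sol_sol) (auto simp: solvable_def intro: finite_subset)
    moreover have "VI_sol F (feasible_set X K \<omega>) (sol I \<omega>)"
      using K by (simp add: VI_unique_sol_def)
    ultimately show ?thesis
      using feasible_set_antimono[OF L(2)] subsetD[OF feasible_set_antimono[OF L(1)] in_feasible]
      by (rule VI_unique_sol_subset)
  qed
  have "S \<subseteq> J"
  proof
    fix i assume "i \<in> S"
    then have i: "i \<in> I" "\<not> VI_unique_sol F (feasible_set X (I - {i}) \<omega>) (sol I \<omega>)"
      by (auto simp: S_def support_set_def)
    show "i \<in> J"
    proof (rule ccontr)
      assume "i \<notin> J"
      then have "VI_unique_sol F (feasible_set X (I - {i}) \<omega>) (sol I \<omega>)"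
        using J(1) assms(2) sol by (intro *[of "I - {i}" J]) auto
      with i show False by simp
    qed
  qed
  moreover have "J \<subseteq> S" \<comment> \<open>a proper subset \<open>S\<close> of \<open>J\<close> solving the problem would make \<open>J\<close> redundant\<close>
  proof
    fix i assume "i \<in> J"
    then have i: "\<not> VI_unique_sol F (feasible_set X (J - {i}) \<omega>) (sol I \<omega>)"
      using J(2) sol by (auto simp: support_set_def)
    show "i \<in> S"
    proof (rule ccontr)
      assume "i \<notin> S"
      moreover have "VI_unique_sol F (feasible_set X S \<omega>) (sol I \<omega>)"
        using assms(4) by (simp add: nondegenerate_def S_def)
      ultimately have "VI_unique_sol F (feasible_set X (J - {i}) \<omega>) (sol I \<omega>)"
        using \<open>S \<subseteq> J\<close> assms(2) by (intro *[of "J - {i}" S]) auto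
      with i show False by simp
    qed
  qed
  ultimately show ?thesis
    by (auto simp: S_def)
qed

section \<open>Measurability of acceptance, irredundance and support\<close>

lemma sets_violation:
  assumes "finite J" "J \<subseteq> I"
  shows "{p \<in> space (samples I \<Otimes>\<^sub>M M). sol J (fst p) \<in> X (snd p)} \<in> sets (samples I \<Otimes>\<^sub>M M)"
proof (cases "J = {}")
  case True
  \<comment> \<open>Without constraints the solution is the same for every sample;
    \<open>undefined\<close> is just some argument.\<close>
  then have "sol J \<omega> = sol {} undefined" for \<omega>
    by (simp add: xstar_def feasible_set_def)
  then have "{p \<in> space (samples I \<Otimes>\<^sub>M M). sol J (fst p) \<in> X (snd p)}
      = snd -` {\<delta> \<in> space M. sol {} undefined \<in> X \<delta>} \<inter> space (samples I \<Otimes>\<^sub>M M)"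
    by (auto simp: space_pair_measure)
  then show ?thesis
    using measurable_sets[OF measurable_snd meas_constraint] by simp
next
  case False
  with assms obtain f m where fm: "m \<ge> 1" "f ` {1..m} = J"
    "\<And>\<omega>. sol J \<omega> = sol {1..m} (\<lambda>j\<in>{1..m}. \<omega> (f j))"
    using reindex by metis
  \<comment> \<open>Along \<open>r\<close> the measurability assumption for \<open>{1..m}\<close> is
    pulled back to \<open>J\<close>.\<close>
  define r where "r = (\<lambda>p :: (nat \<Rightarrow> 'd) \<times> 'd. (\<lambda>j\<in>{1..m}. fst p (f j), snd p))"
  have "(\<lambda>p. fst p (f j)) \<in> samples I \<Otimes>\<^sub>M M \<rightarrow>\<^sub>M M" if "j \<in> {1..m}" for j
    using that fm(2) assms(2)
    by (intro measurable_compose[OF measurable_fst] measurable_component_singleton) auto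
  then have r: "r \<in> samples I \<Otimes>\<^sub>M M \<rightarrow>\<^sub>M samples {1..m} \<Otimes>\<^sub>M M"
    unfolding r_def by (intro measurable_Pair measurable_restrict) auto
  have "{p \<in> space (samples I \<Otimes>\<^sub>M M). sol J (fst p) \<in> X (snd p)}
      = r -` {p \<in> space (samples {1..m} \<Otimes>\<^sub>M M). sol {1..m} (fst p) \<in> X (snd p)}
          \<inter> space (samples I \<Otimes>\<^sub>M M)"
    using measurable_space[OF r] by (auto simp: fm(3) r_def)
  also have "\<dots> \<in> sets (samples I \<Otimes>\<^sub>M M)"
    by (rule measurable_sets[OF r meas_violation[OF fm(1)]])
  finally show ?thesis .
qed

lemma pred_accept:
  assumes "finite J" "J \<subseteq> I" "i \<in> I"
  shows "Measurable.pred (samples I) (\<lambda>\<omega>. sol J \<omega> \<in> X (\<omega> i))"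
proof -
  have "(\<lambda>\<omega>. (\<omega>, \<omega> i)) \<in> samples I \<rightarrow>\<^sub>M samples I \<Otimes>\<^sub>M M"
    using assms(3) by measurable
  from measurable_compose[OF this, of "\<lambda>p. sol J (fst p) \<in> X (snd p)"] sets_violation[OF assms(1,2)]
  show ?thesis by (simp add: pred_def)
qed

lemma measurable_accept_prob [measurable]:
  assumes "finite J" "J \<subseteq> I"
  shows "accept_prob J \<in> borel_measurable (samples I)"
proof -
  let ?Q = "{p \<in> space (samples I \<Otimes>\<^sub>M M). sol J (fst p) \<in> X (snd p)}"
  \<comment> \<open>The acceptance probability is the measure of a section of the measurable set
    \<open>?Q\<close>.\<close>
  have "(\<lambda>\<omega>. enn2real (emeasure M (Pair \<omega> -` ?Q))) \<in> borel_measurable (samples I)"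
    using measurable_emeasure_Pair[OF sets_violation[OF assms]] by measurable
  moreover have "enn2real (emeasure M (Pair \<omega> -` ?Q)) = accept_prob J \<omega>"
    if "\<omega> \<in> space (samples I)" for \<omega>
  proof -
    have "Pair \<omega> -` ?Q = {\<delta> \<in> space M. sol J \<omega> \<in> X \<delta>}"
      using that by (auto simp: space_pair_measure)
    then show ?thesis
      by (simp add: accept_prob_def measure_def)
  qed
  ultimately show ?thesis
    by (simp cong: measurable_cong)
qed

lemma pred_irredundant:
  assumes "finite J" "J \<subseteq> I"
  shows "Measurable.pred (samples I) (irredundant F X J)"
proof -
  have acc: "Measurable.pred (samples I) (\<lambda>\<omega>. sol (J - {i}) \<omega> \<in> X (\<omega> i))" if "i \<in> J" for i
    using assms that by (intro pred_accept) auto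
  have "Measurable.pred (samples I) (\<lambda>\<omega>. solvable J \<and>
      (\<forall>i\<in>J. \<not> (solvable (J - {i}) \<and> sol (J - {i}) \<omega> \<in> X (\<omega> i))))"
    using assms(1) by (intro pred_intros_logic pred_intros_finite acc) auto
  moreover have "irredundant F X J \<omega> \<longleftrightarrow> solvable J \<and>
      (\<forall>i\<in>J. \<not> (solvable (J - {i}) \<and> sol (J - {i}) \<omega> \<in> X (\<omega> i)))"
    if "\<omega> \<in> space (samples I)" for \<omega>
    using assms that by (intro irredundant_iff) (auto simp: space_PiM)
  ultimately show ?thesis
    by (simp cong: measurable_cong)
qed

lemma measurable_card_support_set:
  assumes "finite I"
  shows "(\<lambda>\<omega>. card (support_set F X I \<omega>)) \<in> samples I \<rightarrow>\<^sub>M count_space UNIV"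
proof -
  let ?P = "\<lambda>\<omega> i. \<not> (solvable (I - {i}) \<and> sol (I - {i}) \<omega> \<in> X (\<omega> i))"
  have [measurable]: "Measurable.pred (samples I) (\<lambda>\<omega>. ?P \<omega> i)" if "i \<in> I" for i
    using assms that by (intro pred_intros_logic pred_accept) auto
  have "(\<lambda>\<omega>. \<Sum>i\<in>I. if ?P \<omega> i then 1 else 0 :: nat) \<in> samples I \<rightarrow>\<^sub>M count_space UNIV"
    by measurable
  moreover have "(\<Sum>i\<in>I. if ?P \<omega> i then 1 else 0) = card (support_set F X I \<omega>)"
    if "\<omega> \<in> space (samples I)" for \<omega>
  proof -
    have "\<omega> \<in> I \<rightarrow> space M"
      using that by (auto simp: space_PiM)
    from support_set_eq[OF assms this] show ?thesis
      using assms by (simp add: sum.If_cases Int_def)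
  qed
  ultimately show ?thesis
    by (simp cong: measurable_cong)
qed

section \<open>Integration over the remaining samples\<close>

text \<open>Real-valued, so that joint acceptance by several samples is a product under the
  integral.\<close>

definition accepts :: "nat set \<Rightarrow> nat \<Rightarrow> (nat \<Rightarrow> 'd) \<Rightarrow> real" where
  "accepts J i \<omega> = of_bool (sol J \<omega> \<in> X (\<omega> i))"

lemma accepts_bounds: "0 \<le> accepts J i \<omega>" "accepts J i \<omega> \<le> 1"
  by (simp_all add: accepts_def)

lemma accepts_upd: "i \<notin> J \<Longrightarrow> i \<noteq> j \<Longrightarrow> accepts J j (\<omega> (i := y)) = accepts J j \<omega>"
  by (simp add: accepts_def xstar_upd)

lemma measurable_accepts:
  assumes "finite J" "J \<subseteq> I" "i \<in> I"
  shows "accepts J i \<in> borel_measurable (samples I)"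
  unfolding accepts_def[abs_def] by (intro borel_measurable_of_bool pred_accept assms)

lemma prob_space_samples: "prob_space (samples I)"
  by (intro prob_space_PiM prob_space_axioms)

lemma integrable_bounded:
  fixes G :: "(nat \<Rightarrow> 'd) \<Rightarrow> real"
  assumes "G \<in> borel_measurable (samples I)" "\<And>\<omega>. \<bar>G \<omega>\<bar> \<le> 1"
  shows "integrable (samples I) G"
  using assms
  by (intro finite_measure.integrable_const_bound[where B = 1]
      prob_space.finite_measure[OF prob_space_samples]) auto

text \<open>By Fubini, sample \<open>i\<close> is integrated first. Neither \<open>G\<close> nor the
  solution for \<open>J\<close> depends on it, so the inner integral of \<open>accepts J i\<close>
  is the acceptance probability.\<close>

lemma integral_accepts:
  fixes G :: "(nat \<Rightarrow> 'd) \<Rightarrow> real"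
  assumes I: "finite I" "J \<subseteq> I" "i \<in> I - J"
    and G: "G \<in> borel_measurable (samples I)" "\<And>\<omega>. \<bar>G \<omega>\<bar> \<le> 1"
    and G_upd: "\<And>\<omega> y. G (\<omega> (i := y)) = G \<omega>"
  shows "(\<integral>\<omega>. G \<omega> * accepts J i \<omega> \<partial>samples I) = (\<integral>\<omega>. G \<omega> * accept_prob J \<omega> \<partial>samples I)"
proof -
  define I' where "I' = I - {i}"
  have I': "I = insert i I'" "finite I'" "i \<notin> I'" and iJ: "i \<notin> J" and J: "finite J"
    using I by (auto simp: I'_def intro: finite_subset)
  have int1: "integrable (samples I) (\<lambda>\<omega>. G \<omega> * accepts J i \<omega>)"
    using I J G measurable_accepts[of J I i]
    by (intro integrable_bounded borel_measurable_times abs_mult_le_1 accepts_bounds) auto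
  have int2: "integrable (samples I) (\<lambda>\<omega>. G \<omega> * accept_prob J \<omega>)"
    using I J G measurable_accept_prob[of J I]
    by (intro integrable_bounded borel_measurable_times abs_mult_le_1 accept_prob_bounds) auto
  have acc: "(\<integral>y. accepts J i (\<omega> (i := y)) \<partial>M) = accept_prob J \<omega>" for \<omega>
  proof -
    have "(\<integral>y. accepts J i (\<omega> (i := y)) \<partial>M)
        = (\<integral>y. indicator {\<delta> \<in> space M. sol J \<omega> \<in> X \<delta>} y \<partial>M)"
      using iJ by (intro Bochner_Integration.integral_cong)
        (auto simp: accepts_def xstar_upd indicator_def)
    then show ?thesis
      using meas_constraint by (simp add: accept_prob_def)
  qed
  have "(\<integral>\<omega>. G \<omega> * accepts J i \<omega> \<partial>samples I)
      = (\<integral>\<omega>. (\<integral>y. G (\<omega> (i := y)) * accepts J i (\<omega> (i := y)) \<partial>M) \<partial>samples I')"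
    unfolding I'(1) using int1 I' by (intro samples.product_integral_insert) auto
  also have "\<dots> = (\<integral>\<omega>. (\<integral>y. G (\<omega> (i := y)) * accept_prob J (\<omega> (i := y)) \<partial>M) \<partial>samples I')"
    by (simp add: G_upd acc accept_prob_upd[OF iJ] prob_space)
  also have "\<dots> = (\<integral>\<omega>. G \<omega> * accept_prob J \<omega> \<partial>samples I)"
    unfolding I'(1) using int2 I' by (intro samples.product_integral_insert[symmetric]) auto
  finally show ?thesis .
qed

lemma measurable_prod_accepts:
  assumes "finite I" "J \<subseteq> I" "A \<subseteq> I"
  shows "(\<lambda>\<omega>. \<Prod>i\<in>A. accepts J i \<omega>) \<in> borel_measurable (samples I)"
  using assms by (intro borel_measurable_prod measurable_accepts) (auto intro: finite_subset)

text \<open>Given the samples in \<open>J\<close>, the others accept independently with equal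
  probability, whence the power. The induction removes one sample of \<open>A\<close> at a time and
  generalises over \<open>G\<close>.\<close>

lemma integral_prod_accepts:
  fixes G :: "(nat \<Rightarrow> 'd) \<Rightarrow> real"
  assumes I: "finite I" "J \<subseteq> I" and A: "A \<subseteq> I - J"
    and G: "G \<in> borel_measurable (samples I)" "\<And>\<omega>. \<bar>G \<omega>\<bar> \<le> 1"
    and G_upd: "\<And>i \<omega> y. i \<in> A \<Longrightarrow> G (\<omega> (i := y)) = G \<omega>"
  shows "(\<integral>\<omega>. G \<omega> * (\<Prod>i\<in>A. accepts J i \<omega>) \<partial>samples I)
       = (\<integral>\<omega>. G \<omega> * accept_prob J \<omega> ^ card A \<partial>samples I)"
proof -
  have "finite A"
    using A I(1) by (auto intro: finite_subset)
  then show ?thesis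
    using A G G_upd
  proof (induction A arbitrary: G rule: finite_induct)
    case empty
    then show ?case by simp
  next
    case (insert i A)
    have J: "finite J"
      using I by (auto intro: finite_subset)
    have "(\<integral>\<omega>. G \<omega> * (\<Prod>i\<in>insert i A. accepts J i \<omega>) \<partial>samples I)
        = (\<integral>\<omega>. (G \<omega> * (\<Prod>i\<in>A. accepts J i \<omega>)) * accepts J i \<omega> \<partial>samples I)"
      using insert.hyps by (simp add: mult_ac)
    also have "\<dots> = (\<integral>\<omega>. (G \<omega> * (\<Prod>i\<in>A. accepts J i \<omega>)) * accept_prob J \<omega> \<partial>samples I)"
    proof (rule integral_accepts[OF I])
      show "i \<in> I - J"
        using insert.prems by auto
      show "(\<lambda>\<omega>. G \<omega> * (\<Prod>i\<in>A. accepts J i \<omega>)) \<in> borel_measurable (samples I)"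
        using insert.prems I by (intro borel_measurable_times measurable_prod_accepts) auto
      show "\<bar>G \<omega> * (\<Prod>i\<in>A. accepts J i \<omega>)\<bar> \<le> 1" for \<omega>
        using insert.prems by (intro abs_mult_le_1 prod_nonneg prod_le_1) (auto simp: accepts_bounds)
      have "accepts J j (\<omega> (i := y)) = accepts J j \<omega>" if "j \<in> A" for j \<omega> y
        using that insert.hyps insert.prems(1) by (intro accepts_upd) auto
      moreover have "G (\<omega> (i := y)) = G \<omega>" for \<omega> y
        using insert.prems(4) by blast
      ultimately show "G (\<omega> (i := y)) * (\<Prod>i'\<in>A. accepts J i' (\<omega> (i := y)))
          = G \<omega> * (\<Prod>i\<in>A. accepts J i \<omega>)" for \<omega> y
        by (simp only: cong: prod.cong)
    qed
    \<comment> \<open>The new factor depends on no sample of \<open>A\<close>, so it can be absorbed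
      into \<open>G\<close> before the induction hypothesis is applied.\<close>
    also have "\<dots> = (\<integral>\<omega>. (G \<omega> * accept_prob J \<omega>) * (\<Prod>i\<in>A. accepts J i \<omega>) \<partial>samples I)"
      by (simp add: mult_ac)
    also have "\<dots> = (\<integral>\<omega>. (G \<omega> * accept_prob J \<omega>) * accept_prob J \<omega> ^ card A \<partial>samples I)"
    proof (rule insert.IH)
      show "A \<subseteq> I - J"
        using insert.prems by auto
      show "(\<lambda>\<omega>. G \<omega> * accept_prob J \<omega>) \<in> borel_measurable (samples I)"
        using insert.prems I J by (intro borel_measurable_times measurable_accept_prob) auto
      show "\<bar>G \<omega> * accept_prob J \<omega>\<bar> \<le> 1" for \<omega>
        using insert.prems by (intro abs_mult_le_1 accept_prob_bounds) auto
      show "G (\<omega> (j := y)) * accept_prob J (\<omega> (j := y)) = G \<omega> * accept_prob J \<omega>"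
        if "j \<in> A" for j \<omega> y
      proof -
        have "G (\<omega> (j := y)) = G \<omega>"
          using that insert.prems(4) by blast
        moreover have "accept_prob J (\<omega> (j := y)) = accept_prob J \<omega>"
          using that insert.prems(1) by (intro accept_prob_upd) auto
        ultimately show ?thesis
          by (simp only:)
      qed
    qed
    also have "\<dots> = (\<integral>\<omega>. G \<omega> * accept_prob J \<omega> ^ card (insert i A) \<partial>samples I)"
      using insert.hyps by (simp add: mult_ac)
    finally show ?case .
  qed
qed

section \<open>Irredundant sets that determine the solution of a larger set\<close>

definition generates :: "nat set \<Rightarrow> nat set \<Rightarrow> (nat \<Rightarrow> 'd) \<Rightarrow> bool" where
  "generates J K \<omega> \<longleftrightarrow> irredundant F X J \<omega> \<and> 0 < accept_prob J \<omega> \<and>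
     (\<forall>i\<in>K - J. sol J \<omega> \<in> X (\<omega> i))"

lemma pred_generates:
  assumes "finite I" "J \<subseteq> I" "K \<subseteq> I"
  shows "Measurable.pred (samples I) (generates J K)"
proof -
  have [measurable]: "Measurable.pred (samples I) (irredundant F X J)"
    "accept_prob J \<in> borel_measurable (samples I)"
    using assms by (auto intro!: pred_irredundant measurable_accept_prob intro: finite_subset)
  have acc: "Measurable.pred (samples I) (\<lambda>\<omega>. \<forall>i\<in>K - J. sol J \<omega> \<in> X (\<omega> i))"
    using assms by (intro pred_intros_finite pred_accept) (auto intro: finite_subset)
  show ?thesis
    unfolding generates_def[abs_def] by (intro pred_intros_logic acc) measurable
qed

lemma generates_upd:
  assumes "J \<subseteq> K" "i \<notin> K"
  shows "generates J K (\<omega> (i := y)) = generates J K \<omega>"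
proof -
  have "i \<notin> J"
    using assms by auto
  moreover have "(\<omega> (i := y)) j = \<omega> j" if "j \<in> K - J" for j
    using that assms by auto
  ultimately show ?thesis
    by (simp add: generates_def irredundant_upd accept_prob_upd xstar_upd)
qed

text \<open>If \<open>J1\<close> and \<open>J2\<close> both generate \<open>K\<close> and all
  samples outside \<open>K\<close> accept, non-degeneracy forces both to equal the support set of
  \<open>I\<close>. Thus \<open>G\<close> times the product of acceptances vanishes almost surely;
  integrating out \<open>I - K\<close> replaces the product by a power of the acceptance
  probability.\<close>

lemma AE_generates_unique:
  assumes I: "finite I" "K \<subseteq> I" and J: "J1 \<subseteq> K" "J2 \<subseteq> K" "J1 \<noteq> J2"
    and nondeg: "AE \<omega> in samples I. nondegenerate F X I \<omega>"
  shows "AE \<omega> in samples I. \<not> (generates J1 K \<omega> \<and> generates J2 K \<omega>)"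
proof -
  define G where "G \<omega> = (of_bool (generates J1 K \<omega> \<and> generates J2 K \<omega>) :: real)" for \<omega>
  have J1: "finite J1" "J1 \<subseteq> I" and J2: "finite J2" "J2 \<subseteq> I"
    using I J by (auto dest: finite_subset)
  have G: "G \<in> borel_measurable (samples I)"
    unfolding G_def[abs_def] using I J1 J2
    by (intro borel_measurable_of_bool pred_intros_logic pred_generates) auto
  have G_bounds: "\<bar>G \<omega>\<bar> \<le> 1" for \<omega>
    by (simp add: G_def)
  have G_upd: "G (\<omega> (i := y)) = G \<omega>" if "i \<in> I - K" for i \<omega> y
    using that J by (simp add: G_def generates_upd)
  have "AE \<omega> in samples I. G \<omega> * (\<Prod>i\<in>I - K. accepts J1 i \<omega>) = 0"
    using nondeg AE_space
  proof eventually_elim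
    fix \<omega> assume nd: "nondegenerate F X I \<omega>" and "\<omega> \<in> space (samples I)"
    then have \<omega>: "\<omega> \<in> I \<rightarrow> space M"
      by (auto simp: space_PiM)
    show "G \<omega> * (\<Prod>i\<in>I - K. accepts J1 i \<omega>) = 0"
    proof (rule ccontr)
      assume "\<not> ?thesis"
      then have gen: "generates J1 K \<omega>" "generates J2 K \<omega>"
        and acc: "\<And>i. i \<in> I - K \<Longrightarrow> sol J1 \<omega> \<in> X (\<omega> i)"
        using I by (auto simp: G_def accepts_def prod_zero_iff)
      \<comment> \<open>Both generated solutions equal \<open>sol K\<close>, so samples that accept
        the one accept the other.\<close>
      have sol: "sol K \<omega> = sol J \<omega>" if "J \<subseteq> K" "generates J K \<omega>" for J
      proof (rule sol_eq_sol_subset)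
        show "solvable J"
          using that solvableI by (auto simp: generates_def irredundant_def)
      qed (use that I \<omega> in \<open>auto simp: generates_def intro: finite_subset\<close>)
      have "support_set F X I \<omega> = J" if "J \<subseteq> K" "generates J K \<omega>" for J
      proof (rule irredundant_eq_support_set[OF I(1) _ \<omega> nd])
        show "sol J \<omega> \<in> X (\<omega> i)" if "i \<in> I - J" for i
          using that \<open>generates J K \<omega>\<close> acc[of i] sol[OF \<open>J \<subseteq> K\<close>] sol[OF J(1) gen(1)]
          by (cases "i \<in> K") (auto simp: generates_def)
      qed (use that I in \<open>auto simp: generates_def\<close>)
      with gen J show False by blast
    qed
  qed
  then have "(\<integral>\<omega>. G \<omega> * (\<Prod>i\<in>I - K. accepts J1 i \<omega>) \<partial>samples I) = 0"
    by (rule integral_eq_zero_AE)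
  moreover have "(\<integral>\<omega>. G \<omega> * (\<Prod>i\<in>I - K. accepts J1 i \<omega>) \<partial>samples I)
      = (\<integral>\<omega>. G \<omega> * accept_prob J1 \<omega> ^ card (I - K) \<partial>samples I)"
    using I J1 J G G_bounds G_upd by (intro integral_prod_accepts) auto
  ultimately have "(\<integral>\<omega>. G \<omega> * accept_prob J1 \<omega> ^ card (I - K) \<partial>samples I) = 0"
    by simp
  moreover have "integrable (samples I) (\<lambda>\<omega>. G \<omega> * accept_prob J1 \<omega> ^ card (I - K))"
    using G measurable_accept_prob[OF J1] accept_prob_bounds
    by (intro integrable_bounded borel_measurable_times borel_measurable_power abs_mult_le_1
        zero_le_power power_le_one G_bounds) auto
  ultimately have "AE \<omega> in samples I. G \<omega> * accept_prob J1 \<omega> ^ card (I - K) = 0"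
    using accept_prob_bounds by (subst (asm) integral_nonneg_eq_0_iff_AE) (auto simp: G_def)
  \<comment> \<open>The positivity of \<open>accept_prob\<close> in \<open>generates\<close>
    excludes that the power, rather than \<open>G\<close>, is zero.\<close>
  then show ?thesis
    by eventually_elim (auto simp: G_def generates_def)
qed

text \<open>For \<open>a = card (K - J)\<close> this is the probability that \<open>J\<close>
  generates \<open>K\<close>.\<close>

definition mass :: "nat set \<Rightarrow> nat set \<Rightarrow> nat \<Rightarrow> real" where
  "mass I J a = (\<integral>\<omega>. of_bool (irredundant F X J \<omega> \<and> 0 < accept_prob J \<omega>)
      * accept_prob J \<omega> ^ a \<partial>samples I)"

text \<open>The predicate \<open>P\<close> is kept general to cover both positive acceptance
  probability and risk above a threshold.\<close>

lemma measurable_irredundant_accept_prob: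
  assumes "finite J" "J \<subseteq> I" "Measurable.pred borel P"
  shows "(\<lambda>\<omega>. of_bool (irredundant F X J \<omega> \<and> P (accept_prob J \<omega>)) :: real)
    \<in> borel_measurable (samples I)"
  using measurable_compose[OF measurable_accept_prob[OF assms(1,2)] assms(3)]
  by (intro borel_measurable_of_bool pred_intros_logic pred_irredundant assms)

lemma integrable_irredundant_accept_prob:
  assumes "finite J" "J \<subseteq> I" "Measurable.pred borel P"
  shows "integrable (samples I) (\<lambda>\<omega>. of_bool (irredundant F X J \<omega> \<and> P (accept_prob J \<omega>))
      * accept_prob J \<omega> ^ a)"
  using measurable_irredundant_accept_prob[OF assms] measurable_accept_prob[OF assms(1,2)]
    accept_prob_bounds
  by (intro integrable_bounded borel_measurable_times borel_measurable_power abs_mult_le_1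
      zero_le_power power_le_one) auto

text \<open>The masses are the probabilities of the events \<open>generates J K\<close>, of which
  almost surely at most one occurs.\<close>

lemma sum_mass_le_1:
  assumes I: "finite I" "K \<subseteq> I"
    and nondeg: "AE \<omega> in samples I. nondegenerate F X I \<omega>"
  shows "(\<Sum>J\<in>Pow K. mass I J (card (K - J))) \<le> 1"
proof -
  have K: "finite K"
    using I by (auto intro: finite_subset)
  have mass: "mass I J (card (K - J)) = (\<integral>\<omega>. of_bool (generates J K \<omega>) \<partial>samples I)"
    if "J \<in> Pow K" for J
  proof -
    have J: "finite J" "J \<subseteq> I"
      using that I by (auto intro: finite_subset)
    have "mass I J (card (K - J)) = (\<integral>\<omega>. of_bool (irredundant F X J \<omega> \<and> 0 < accept_prob J \<omega>)
        * (\<Prod>i\<in>K - J. accepts J i \<omega>) \<partial>samples I)"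
      unfolding mass_def using I J that measurable_irredundant_accept_prob[OF J, of "\<lambda>x. 0 < x"]
      by (intro integral_prod_accepts[symmetric]) (auto simp: irredundant_upd accept_prob_upd)
    also have "\<dots> = (\<integral>\<omega>. of_bool (generates J K \<omega>) \<partial>samples I)"
      using K by (intro Bochner_Integration.integral_cong) (auto simp: generates_def accepts_def)
    finally show ?thesis .
  qed
  have int: "integrable (samples I) (\<lambda>\<omega>. of_bool (generates J K \<omega>) :: real)" if "J \<in> Pow K" for J
    using that I by (intro integrable_bounded borel_measurable_of_bool pred_generates) auto
  have "AE \<omega> in samples I. \<forall>J1\<in>Pow K. \<forall>J2\<in>Pow K.
      J1 \<noteq> J2 \<longrightarrow> \<not> (generates J1 K \<omega> \<and> generates J2 K \<omega>)"
    using I K nondeg by (intro AE_finite_allI AE_impI AE_generates_unique) auto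
  then have "AE \<omega> in samples I. (\<Sum>J\<in>Pow K. of_bool (generates J K \<omega>) :: real) \<le> 1"
  proof eventually_elim
    fix \<omega>
    assume "\<forall>J1\<in>Pow K. \<forall>J2\<in>Pow K. J1 \<noteq> J2 \<longrightarrow> \<not> (generates J1 K \<omega> \<and> generates J2 K \<omega>)"
    then have "card {J \<in> Pow K. generates J K \<omega>} \<le> Suc 0"
      using K by (subst card_le_Suc0_iff_eq) auto
    moreover have "(\<Sum>J\<in>Pow K. of_bool (generates J K \<omega>) :: real) = card {J \<in> Pow K. generates J K \<omega>}"
      using K by (simp add: of_bool_def sum.If_cases Int_def)
    ultimately show "(\<Sum>J\<in>Pow K. of_bool (generates J K \<omega>) :: real) \<le> 1"
      by simp
  qed
  then have "(\<integral>\<omega>. (\<Sum>J\<in>Pow K. of_bool (generates J K \<omega>) :: real) \<partial>samples I)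
      \<le> (\<integral>\<omega>. 1 \<partial>samples I)"
    using int by (intro integral_mono_AE Bochner_Integration.integrable_sum) auto
  then show ?thesis
    using int by (simp add: mass prob_space.prob_space[OF prob_space_samples])
qed

section \<open>The risk bound\<close>

text \<open>Almost surely, a bad sample is counted at \<open>J\<close> equal to its support set:
  that set is irredundant, has the same solution, and is accepted by the rest. The union bound over
  all \<open>J\<close> and integration over \<open>I - J\<close> give the sum.\<close>

lemma prob_risk_gt_le_sum:
  assumes I: "finite I" and nondeg: "AE \<omega> in samples I. nondegenerate F X I \<omega>"
    and \<epsilon>: "\<epsilon> (card I) \<ge> 1"
  shows "measure (samples I) {\<omega> \<in> space (samples I). \<epsilon> (card (support_set F X I \<omega>)) < risk M X (sol I \<omega>)}
    \<le> (\<Sum>J\<in>Pow I. \<integral>\<omega>. of_bool (irredundant F X J \<omega> \<and> \<epsilon> (card J) < 1 - accept_prob J \<omega>)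
          * accept_prob J \<omega> ^ card (I - J) \<partial>samples I)"
proof -
  let ?bad = "\<lambda>\<omega>. \<epsilon> (card (support_set F X I \<omega>)) < risk M X (sol I \<omega>)"
  let ?G = "\<lambda>J \<omega>. of_bool (irredundant F X J \<omega> \<and> \<epsilon> (card J) < 1 - accept_prob J \<omega>) :: real"
  have G: "?G J \<in> borel_measurable (samples I)" if "J \<in> Pow I" for J
    using that I measurable_irredundant_accept_prob[of J I "\<lambda>x. \<epsilon> (card J) < 1 - x"]
    by (auto intro: finite_subset)
  have G_prod: "(\<integral>\<omega>. ?G J \<omega> * (\<Prod>i\<in>I - J. accepts J i \<omega>) \<partial>samples I)
      = (\<integral>\<omega>. ?G J \<omega> * accept_prob J \<omega> ^ card (I - J) \<partial>samples I)" if "J \<in> Pow I" for J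
    using that I G[OF that]
    by (intro integral_prod_accepts) (auto simp: irredundant_upd accept_prob_upd)
  have int: "integrable (samples I) (\<lambda>\<omega>. ?G J \<omega> * (\<Prod>i\<in>I - J. accepts J i \<omega>))"
    if "J \<in> Pow I" for J
    using that I G[OF that]
    by (intro integrable_bounded borel_measurable_times measurable_prod_accepts abs_mult_le_1
        prod_nonneg prod_le_1) (auto simp: accepts_bounds)
  have [measurable]: "accept_prob I \<in> borel_measurable (samples I)"
    "(\<lambda>\<omega>. card (support_set F X I \<omega>)) \<in> samples I \<rightarrow>\<^sub>M count_space UNIV"
    using I by (auto intro: measurable_accept_prob measurable_card_support_set)
  have bad: "Measurable.pred (samples I) ?bad"
    unfolding risk_eq by measurable
  have "measure (samples I) {\<omega> \<in> space (samples I). ?bad \<omega>} = (\<integral>\<omega>. of_bool (?bad \<omega>) \<partial>samples I)"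
  proof -
    have "(\<integral>\<omega>. of_bool (?bad \<omega>) \<partial>samples I)
        = (\<integral>\<omega>. indicator {\<omega> \<in> space (samples I). ?bad \<omega>} \<omega> \<partial>samples I)"
      by (intro Bochner_Integration.integral_cong) (auto simp: indicator_def)
    also have "\<dots> = measure (samples I) ({\<omega> \<in> space (samples I). ?bad \<omega>} \<inter> space (samples I))"
      by (rule Bochner_Integration.integral_indicator)
    also have "{\<omega> \<in> space (samples I). ?bad \<omega>} \<inter> space (samples I) = {\<omega> \<in> space (samples I). ?bad \<omega>}"
      by auto
    finally show ?thesis ..
  qed
  also have "\<dots> \<le> (\<integral>\<omega>. (\<Sum>J\<in>Pow I. ?G J \<omega> * (\<Prod>i\<in>I - J. accepts J i \<omega>)) \<partial>samples I)"
  proof (rule integral_mono_AE)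
    show "integrable (samples I) (\<lambda>\<omega>. of_bool (?bad \<omega>) :: real)"
      using bad by (intro integrable_bounded borel_measurable_of_bool) auto
    show "integrable (samples I) (\<lambda>\<omega>. \<Sum>J\<in>Pow I. ?G J \<omega> * (\<Prod>i\<in>I - J. accepts J i \<omega>))"
      using int by (intro Bochner_Integration.integrable_sum) auto
    show "AE \<omega> in samples I. of_bool (?bad \<omega>) \<le> (\<Sum>J\<in>Pow I. ?G J \<omega> * (\<Prod>i\<in>I - J. accepts J i \<omega>))"
      using nondeg AE_space
    proof eventually_elim
      fix \<omega> assume nd: "nondegenerate F X I \<omega>" and "\<omega> \<in> space (samples I)"
      then have "\<omega> \<in> I \<rightarrow> space M"
        by (auto simp: space_PiM)
      note S = support_set_nondegenerate[OF I this nd]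
      let ?S = "support_set F X I \<omega>"
      \<comment> \<open>On a bad sample the right-hand side is 1, as all samples outside
        \<open>?S\<close> accept its solution.\<close>
      have "of_bool (?bad \<omega>) \<le> ?G ?S \<omega> * (\<Prod>i\<in>I - ?S. accepts ?S i \<omega>)"
        using S by (auto simp: accepts_def risk_eq[symmetric])
      also have "\<dots> \<le> (\<Sum>J\<in>Pow I. ?G J \<omega> * (\<Prod>i\<in>I - J. accepts J i \<omega>))"
        using I support_set_subset[of F X I \<omega>]
        by (intro member_le_sum mult_nonneg_nonneg prod_nonneg) (auto simp: accepts_bounds)
      finally show "of_bool (?bad \<omega>) \<le> (\<Sum>J\<in>Pow I. ?G J \<omega> * (\<Prod>i\<in>I - J. accepts J i \<omega>))" .
    qed
  qed
  also have "\<dots> = (\<Sum>J\<in>Pow I. \<integral>\<omega>. ?G J \<omega> * (\<Prod>i\<in>I - J. accepts J i \<omega>) \<partial>samples I)"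
    using int by (intro Bochner_Integration.integral_sum) auto
  also have "\<dots> = (\<Sum>J\<in>Pow I. \<integral>\<omega>. ?G J \<omega> * accept_prob J \<omega> ^ card (I - J) \<partial>samples I)"
    by (intro sum.cong refl G_prod)
  finally show ?thesis .
qed

text \<open>The pointwise polynomial bound replaces each term by a weighted sum over the supersets
  \<open>K\<close> of \<open>J\<close>. For fixed \<open>K\<close> the masses sum to at most 1, and
  the weights sum to \<beta>.\<close>

lemma prob_risk_gt_scen_eps_le:
  assumes I: "finite I" and nondeg: "AE \<omega> in samples I. nondegenerate F X I \<omega>"
    and \<beta>: "0 < \<beta>" "\<beta> < 1"
  shows "measure (samples I) {\<omega> \<in> space (samples I).
      scen_eps (card I) \<beta> (card (support_set F X I \<omega>)) < risk M X (sol I \<omega>)} \<le> \<beta>"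
proof -
  let ?w = "\<lambda>K. subset_weight (card I) \<beta> (card K)"
  let ?a = "\<lambda>J. accept_prob J"
  have J: "finite J" "J \<subseteq> I" if "J \<in> Pow I" for J
    using that I by (auto intro: finite_subset)
  have int: "integrable (samples I) (\<lambda>\<omega>. of_bool (irredundant F X J \<omega> \<and> 0 < ?a J \<omega>) * ?a J \<omega> ^ b)"
    if "J \<in> Pow I" for J b
    using integrable_irredundant_accept_prob[OF J[OF that], of "\<lambda>x. 0 < x"] by simp
  have w: "0 \<le> ?w K" for K :: "nat set"
    using \<beta> by (simp add: subset_weight_def)
  have "measure (samples I) {\<omega> \<in> space (samples I).
      scen_eps (card I) \<beta> (card (support_set F X I \<omega>)) < risk M X (sol I \<omega>)}
    \<le> (\<Sum>J\<in>Pow I. \<integral>\<omega>. of_bool (irredundant F X J \<omega> \<and> scen_eps (card I) \<beta> (card J) < 1 - ?a J \<omega>)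
          * ?a J \<omega> ^ card (I - J) \<partial>samples I)"
    using I nondeg by (rule prob_risk_gt_le_sum) (simp add: scen_eps_def scen_t_def)
  also have "\<dots> \<le> (\<Sum>J\<in>Pow I. \<integral>\<omega>. (\<Sum>K\<in>{K \<in> Pow I. J \<subseteq> K}.
      ?w K * (of_bool (irredundant F X J \<omega> \<and> 0 < ?a J \<omega>) * ?a J \<omega> ^ card (K - J))) \<partial>samples I)"
  proof (intro sum_mono integral_mono)
    fix J \<omega> assume "J \<in> Pow I"
    show "of_bool (irredundant F X J \<omega> \<and> scen_eps (card I) \<beta> (card J) < 1 - ?a J \<omega>)
          * ?a J \<omega> ^ card (I - J)
        \<le> (\<Sum>K\<in>{K \<in> Pow I. J \<subseteq> K}.
          ?w K * (of_bool (irredundant F X J \<omega> \<and> 0 < ?a J \<omega>) * ?a J \<omega> ^ card (K - J)))"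
    proof (cases "irredundant F X J \<omega> \<and> scen_eps (card I) \<beta> (card J) < 1 - ?a J \<omega>")
      case True
      then have "?a J \<omega> < scen_t (card I) \<beta> (card J)"
        by (simp add: scen_eps_def)
      from power_le_sum_supersets_weight[OF I _ \<beta> accept_prob_bounds(1) this] True \<open>J \<in> Pow I\<close>
      show ?thesis
        by simp
    next
      case False
      then show ?thesis
        using w accept_prob_bounds by (auto intro!: sum_nonneg mult_nonneg_nonneg)
    qed
  next
    fix J assume JI: "J \<in> Pow I"
    show "integrable (samples I) (\<lambda>\<omega>. of_bool (irredundant F X J \<omega>
        \<and> scen_eps (card I) \<beta> (card J) < 1 - ?a J \<omega>) * ?a J \<omega> ^ card (I - J))"
      using integrable_irredundant_accept_prob[OF J[OF JI],
          of "\<lambda>x. scen_eps (card I) \<beta> (card J) < 1 - x"] by simp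
    show "integrable (samples I) (\<lambda>\<omega>. \<Sum>K\<in>{K \<in> Pow I. J \<subseteq> K}.
        ?w K * (of_bool (irredundant F X J \<omega> \<and> 0 < ?a J \<omega>) * ?a J \<omega> ^ card (K - J)))"
      using JI by (intro Bochner_Integration.integrable_sum integrable_mult_right int)
  qed
  also have "\<dots> = (\<Sum>J\<in>Pow I. \<Sum>K\<in>{K \<in> Pow I. J \<subseteq> K}. ?w K * mass I J (card (K - J)))"
    unfolding mass_def
    by (intro sum.cong refl, subst Bochner_Integration.integral_sum)
      (auto intro!: integrable_mult_right int)
  \<comment> \<open>Exchanging the sums groups the pairs \<open>J \<subseteq> K\<close> by
    \<open>K\<close>, as \<open>sum_mass_le_1\<close> requires.\<close>
  also have "\<dots> = (\<Sum>K\<in>Pow I. \<Sum>J\<in>{J \<in> Pow I. J \<subseteq> K}. ?w K * mass I J (card (K - J)))"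
    using I by (intro sum.swap_restrict) auto
  also have "\<dots> = (\<Sum>K\<in>Pow I. ?w K * (\<Sum>J\<in>Pow K. mass I J (card (K - J))))"
    unfolding sum_distrib_left by (intro sum.cong) auto
  also have "\<dots> \<le> (\<Sum>K\<in>Pow I. ?w K * 1)"
    using I nondeg w by (intro sum_mono mult_left_mono sum_mass_le_1) auto
  also have "\<dots> = \<beta>"
    using sum_subset_weight[OF I] by simp
  finally show ?thesis .
qed

lemma prob_risk_le_scen_eps:
  assumes I: "finite I" and nondeg: "AE \<omega> in samples I. nondegenerate F X I \<omega>"
    and \<beta>: "0 < \<beta>" "\<beta> < 1"
  shows "1 - \<beta> \<le> measure (samples I) {\<omega> \<in> space (samples I).
      risk M X (sol I \<omega>) \<le> scen_eps (card I) \<beta> (card (support_set F X I \<omega>))}"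
proof -
  let ?bad = "{\<omega> \<in> space (samples I).
      scen_eps (card I) \<beta> (card (support_set F X I \<omega>)) < risk M X (sol I \<omega>)}"
  have [measurable]: "accept_prob I \<in> borel_measurable (samples I)"
    "(\<lambda>\<omega>. card (support_set F X I \<omega>)) \<in> samples I \<rightarrow>\<^sub>M count_space UNIV"
    using I by (auto intro: measurable_accept_prob measurable_card_support_set)
  have "?bad \<in> sets (samples I)"
    unfolding risk_eq by measurable
  then have "measure (samples I) (space (samples I) - ?bad) = 1 - measure (samples I) ?bad"
    by (rule prob_space.prob_compl[OF prob_space_samples])
  moreover have "space (samples I) - ?bad = {\<omega> \<in> space (samples I).
      risk M X (sol I \<omega>) \<le> scen_eps (card I) \<beta> (card (support_set F X I \<omega>))}"
    by auto
  ultimately show ?thesis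
    using prob_risk_gt_scen_eps_le[OF assms] by simp
qed

lemma sets_risk_le:
  assumes "finite I"
  shows "{\<omega> \<in> space (samples I). risk M X (sol I \<omega>) \<le> c} \<in> sets (samples I)"
proof -
  have [measurable]: "accept_prob I \<in> borel_measurable (samples I)"
    using assms by (auto intro: measurable_accept_prob)
  show ?thesis
    unfolding risk_eq by measurable
qed

end

section \<open>Convex constraints and the final bounds\<close>

lemma card_support_set_le_DIM:
  fixes F :: "'a::euclidean_space \<Rightarrow> 'a"
  assumes "VI_scenario M F X" and I: "finite I" "\<omega> \<in> I \<rightarrow> space M"
    and conv: "\<And>\<delta>. \<delta> \<in> space M \<Longrightarrow> convex (X \<delta>)"
  shows "card (support_set F X I \<omega>) \<le> DIM('a)"
proof (cases "card I \<le> 1")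
  \<comment> \<open>With at most one sample its removal may leave a problem without a unique
    solution, so the Helly argument is replaced by counting.\<close>
  case True
  have "card (support_set F X I \<omega>) \<le> card I"
    using I by (intro card_mono support_set_subset)
  also have "\<dots> \<le> DIM('a)"
    using True DIM_positive[where 'a = 'a] by linarith
  finally show ?thesis .
next
  case False
  interpret VI_scenario M F X by fact
  have unique: "VI_unique_sol F (feasible_set X J \<omega>) (sol J \<omega>)" if "J \<subseteq> I" "J \<noteq> {}" for J
    using that I by (intro VI_unique_sol_sol) (auto simp: solvable_def intro: finite_subset)
  show ?thesis
  proof (rule card_VI_support_le_DIM)
    show "finite (support_set F X I \<omega>)"
      using I(1) support_set_subset by (rule finite_subset[rotated])
    show "support_set F X I \<omega> \<subseteq> I"
      by (rule support_set_subset)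
    show "convex (X (\<omega> i))" if "i \<in> I" for i
      using that I conv by auto
    show "VI_sol F (\<Inter>i\<in>I. X (\<omega> i)) (sol I \<omega>)"
    proof -
      have "I \<noteq> {}"
        using False by auto
      with unique[of I] show ?thesis
        by (simp add: VI_unique_sol_def feasible_set_def)
    qed
    show "\<not> VI_sol F (\<Inter>j\<in>I - {i}. X (\<omega> j)) (sol I \<omega>)" if i: "i \<in> support_set F X I \<omega>" for i
    proof
      assume "VI_sol F (\<Inter>j\<in>I - {i}. X (\<omega> j)) (sol I \<omega>)"
      \<comment> \<open>Support means not being the unique solution, while the Helly argument needs
        failure to be a solution. On a nonempty index set the two agree, by existence and
        uniqueness.\<close>
      moreover have "I - {i} \<noteq> {}"
        using False card_mono[of "{i}" I] by auto
      ultimately have "VI_unique_sol F (feasible_set X (I - {i}) \<omega>) (sol I \<omega>)"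
        using unique[of "I - {i}"] unfolding VI_unique_sol_def feasible_set_def
        by (metis Diff_subset)
      with i show False
        by (simp add: support_set_def)
    qed
  qed
qed

theorem theorem1:
  fixes N :: nat and \<beta> :: real
    and F :: "real ^ 'n \<Rightarrow> real ^ 'n"
    and M :: "'d measure"
    and X :: "'d \<Rightarrow> (real ^ 'n) set"
  assumes N: "N \<ge> 1"
    and beta: "0 < \<beta>" "\<beta> < 1"
    and prob: "prob_space M"
    and exists_unique:
      "\<And>m \<omega>. m \<ge> 1 \<Longrightarrow> \<omega> \<in> space (Pi\<^sub>M {1..m} (\<lambda>_. M)) \<Longrightarrow>
         \<exists>!x. VI_sol F (feasible_set X {1..m} \<omega>) x"
    and nondegenerate:
      "AE \<omega> in Pi\<^sub>M {1..N} (\<lambda>_. M). nondegenerate F X {1..N} \<omega>"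
    and meas_constraint:
      "\<And>x. {\<delta> \<in> space M. x \<in> X \<delta>} \<in> sets M"
    and meas_solution:
      "\<And>m. m \<ge> 1 \<Longrightarrow> xstar F X {1..m} \<in> borel_measurable (Pi\<^sub>M {1..m} (\<lambda>_. M))"
    and meas_violation:
      "\<And>m. m \<ge> 1 \<Longrightarrow>
         {p \<in> space (Pi\<^sub>M {1..m} (\<lambda>_. M) \<Otimes>\<^sub>M M). xstar F X {1..m} (fst p) \<in> X (snd p)}
           \<in> sets (Pi\<^sub>M {1..m} (\<lambda>_. M) \<Otimes>\<^sub>M M)"
  shows
    "measure (Pi\<^sub>M {1..N} (\<lambda>_. M))
       {\<omega> \<in> space (Pi\<^sub>M {1..N} (\<lambda>_. M)).
          risk M X (xstar F X {1..N} \<omega>) \<le> scen_eps N \<beta> (card (support_set F X {1..N} \<omega>))}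
       \<ge> 1 - \<beta>
     \<and> ((\<forall>\<delta>\<in>space M. convex (X \<delta>)) \<longrightarrow>
          (\<forall>\<omega>\<in>space (Pi\<^sub>M {1..N} (\<lambda>_. M)). card (support_set F X {1..N} \<omega>) \<le> CARD('n))
          \<and> measure (Pi\<^sub>M {1..N} (\<lambda>_. M))
              {\<omega> \<in> space (Pi\<^sub>M {1..N} (\<lambda>_. M)).
                 risk M X (xstar F X {1..N} \<omega>) \<le> scen_eps N \<beta> (CARD('n))}
              \<ge> 1 - \<beta>)"
proof -
  have scenario: "VI_scenario M F X"
    using prob exists_unique meas_constraint meas_violation
    by (simp add: VI_scenario_def VI_scenario_axioms_def)
  then interpret VI_scenario M F X .
  have part1: "1 - \<beta> \<le> measure (samples {1..N}) {\<omega> \<in> space (samples {1..N}).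
      risk M X (sol {1..N} \<omega>) \<le> scen_eps N \<beta> (card (support_set F X {1..N} \<omega>))}"
    using prob_risk_le_scen_eps[OF _ nondegenerate beta] by simp
  moreover {
    assume conv: "\<forall>\<delta>\<in>space M. convex (X \<delta>)"
    have card: "card (support_set F X {1..N} \<omega>) \<le> CARD('n)" if "\<omega> \<in> space (samples {1..N})" for \<omega>
      using card_support_set_le_DIM[OF scenario, of "{1..N}" \<omega>] conv that by (auto simp: space_PiM)
    \<comment> \<open>Since \<epsilon> is monotone and the number of support constraints is at most
      the dimension, the event of the first part is contained in that of the second.\<close>
    have "measure (samples {1..N}) {\<omega> \<in> space (samples {1..N}).
        risk M X (sol {1..N} \<omega>) \<le> scen_eps N \<beta> (card (support_set F X {1..N} \<omega>))}
      \<le> measure (samples {1..N}) {\<omega> \<in> space (samples {1..N}).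
        risk M X (sol {1..N} \<omega>) \<le> scen_eps N \<beta> CARD('n)}"
      using card scen_eps_mono[OF beta]
      by (intro finite_measure.finite_measure_mono prob_space.finite_measure prob_space_samples
          sets_risk_le) (auto intro: order_trans)
    with part1 card have "(\<forall>\<omega>\<in>space (samples {1..N}). card (support_set F X {1..N} \<omega>) \<le> CARD('n))
        \<and> 1 - \<beta> \<le> measure (samples {1..N}) {\<omega> \<in> space (samples {1..N}).
          risk M X (sol {1..N} \<omega>) \<le> scen_eps N \<beta> CARD('n)}"
      by auto
  }
  ultimately show ?thesis
    by blast
qed

end
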